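(* Any finite affine algebra is dualizable. In particular, any finite module (over any ring) is dualizable.
   Context: An algebra $\mathbf{A}$ is affine if there is an abelian group structure $(A;+,-,0)$ on its universe such that $x-y+z$ is a term operation of $\mathbf{A}$ and every term operation $t$ of $\mathbf{A}$ satisfies $t(\bar x-\bar y+\bar z)=t(\bar x)-t(\bar y)+t(\bar z)$. A module over a ring is viewed as an algebra whose operations are the abelian group operations and one unary operation for each ring element. Dualizable (standard notion of natural duality theory): $\mathsf{SP}(\mathbf{A})$ is the class of all algebras isomorphic to subalgebras of powers of $\mathbf{A}$. A compatible relation of $\mathbf{A}$ is a nonempty subuniverse of some finite power $\mathbf{A}^n$, $n\ge1$. A finite algebra $\mathbf{A}$ is dualizable if there is a set $R$ of compatible relations of $\mathbf{A}$ such that for every $\mathbf{B}\in\mathsf{SP}(\mathbf{A})$, every continuous map $f\colon\mathrm{Hom}(\mathbf{B},\mathbf{A})\to A$ preserving all relations in $R$ is evaluation $h\mapsto h(b)$ at some $b\in B$; here $A$ is discrete, $\mathrm{Hom}(\mathbf{B},\mathbf{A})$ is a subspace of the product space $A^B$, and its relations are defined pointwise. *)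

theory Defs
  imports "HOL-Algebra.Module" "HOL-Analysis.Function_Topology"
begin

section \<open>Algebras in the sense of universal algebra\<close>

text \<open>
  The signature is part of the algebra. Only symbols in \<open>Symbols\<close> belong to it, so that the
  empty signature is allowed. The values of \<open>Op f\<close> matter only on lists of length \<open>Arity f\<close>
  with entries in the universe.
\<close>

record ('f, 'a) ualg =
  Universe :: "'a set"
  Symbols :: "'f set"
  Arity :: "'f \<Rightarrow> nat"
  Op :: "'f \<Rightarrow> 'a list \<Rightarrow> 'a"

definition args :: "('f, 'a) ualg \<Rightarrow> 'f \<Rightarrow> 'a set \<Rightarrow> 'a list set" where
  "args A f S = {xs. length xs = Arity A f \<and> set xs \<subseteq> S}"

definition closed_under_ops :: "('f, 'a) ualg \<Rightarrow> 'a set \<Rightarrow> bool" where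
  "closed_under_ops A S \<longleftrightarrow> (\<forall>f\<in>Symbols A. \<forall>xs\<in>args A f S. Op A f xs \<in> S)"

definition is_algebra :: "('f, 'a) ualg \<Rightarrow> bool" where
  "is_algebra A \<longleftrightarrow> Universe A \<noteq> {} \<and> closed_under_ops A (Universe A)"

definition subuniverse :: "('f, 'a) ualg \<Rightarrow> 'a set \<Rightarrow> bool" where
  "subuniverse A S \<longleftrightarrow> S \<subseteq> Universe A \<and> closed_under_ops A S"

definition subalg :: "('f, 'a) ualg \<Rightarrow> 'a set \<Rightarrow> ('f, 'a) ualg" where
  "subalg A S = A\<lparr>Universe := S\<rparr>"

definition similar :: "('f, 'b) ualg \<Rightarrow> ('f, 'a) ualg \<Rightarrow> bool" where
  "similar B A \<longleftrightarrow> Symbols B = Symbols A \<and> (\<forall>f\<in>Symbols A. Arity B f = Arity A f)"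

text \<open>Homomorphisms are extensional, so that \<open>Hom B A\<close> is a subset of the product \<open>A\<^sup>B\<close>.\<close>

definition Hom :: "('f, 'b) ualg \<Rightarrow> ('f, 'a) ualg \<Rightarrow> ('b \<Rightarrow> 'a) set" where
  "Hom B A = {h \<in> Universe B \<rightarrow>\<^sub>E Universe A.
     \<forall>f\<in>Symbols B. \<forall>xs\<in>args B f (Universe B). h (Op B f xs) = Op A f (map h xs)}"

definition isomorphic :: "('f, 'b) ualg \<Rightarrow> ('f, 'a) ualg \<Rightarrow> bool" where
  "isomorphic B A \<longleftrightarrow> similar B A \<and> (\<exists>h\<in>Hom B A. bij_betw h (Universe B) (Universe A))"

definition power_alg :: "('f, 'a) ualg \<Rightarrow> 'i set \<Rightarrow> ('f, 'i \<Rightarrow> 'a) ualg" where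
  "power_alg A I =
     \<lparr>Universe = I \<rightarrow>\<^sub>E Universe A,
      Symbols = Symbols A,
      Arity = Arity A,
      Op = (\<lambda>f xs. \<lambda>i\<in>I. Op A f (map (\<lambda>x. x i) xs))\<rparr>"


section \<open>Term operations and affine algebras\<close>

datatype 'f uterm = Var nat | App 'f "'f uterm list"

fun wf_term :: "('f, 'a) ualg \<Rightarrow> nat \<Rightarrow> 'f uterm \<Rightarrow> bool" where
  "wf_term A n (Var i) \<longleftrightarrow> i < n"
| "wf_term A n (App f ts) \<longleftrightarrow>
     f \<in> Symbols A \<and> length ts = Arity A f \<and> (\<forall>t\<in>set ts. wf_term A n t)"

fun eval_term :: "('f, 'a) ualg \<Rightarrow> (nat \<Rightarrow> 'a) \<Rightarrow> 'f uterm \<Rightarrow> 'a" where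
  "eval_term A x (Var i) = x i"
| "eval_term A x (App f ts) = Op A f (map (eval_term A x) ts)"

text \<open>As in \<open>power_alg A {..<n}\<close>, \<open>n\<close>-tuples are extensional functions on \<open>{..<n}\<close>.\<close>

definition term_operation :: "('f, 'a) ualg \<Rightarrow> nat \<Rightarrow> ((nat \<Rightarrow> 'a) \<Rightarrow> 'a) \<Rightarrow> bool" where
  "term_operation A n g \<longleftrightarrow>
     (\<exists>t. wf_term A n t \<and> (\<forall>x \<in> {..<n} \<rightarrow>\<^sub>E Universe A. g x = eval_term A x t))"

text \<open>
  In \<open>HOL-Algebra\<close> additive abelian groups live on ring records; \<open>abelian_group\<close> does not
  constrain the multiplicative fields.
\<close>

definition affine_algebra :: "('f, 'a) ualg \<Rightarrow> bool" where
  "affine_algebra A \<longleftrightarrow>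
     (\<exists>G :: 'a ring. abelian_group G \<and> carrier G = Universe A \<and>
        term_operation A 3 (\<lambda>x. x 0 \<ominus>\<^bsub>G\<^esub> x 1 \<oplus>\<^bsub>G\<^esub> x 2) \<and>
        (\<forall>n t. term_operation A n t \<longrightarrow>
           (\<forall>x \<in> {..<n} \<rightarrow>\<^sub>E Universe A. \<forall>y \<in> {..<n} \<rightarrow>\<^sub>E Universe A. \<forall>z \<in> {..<n} \<rightarrow>\<^sub>E Universe A.
              t (\<lambda>i\<in>{..<n}. x i \<ominus>\<^bsub>G\<^esub> y i \<oplus>\<^bsub>G\<^esub> z i) = t x \<ominus>\<^bsub>G\<^esub> t y \<oplus>\<^bsub>G\<^esub> t z)))"


section \<open>Modules as algebras\<close>

text \<open>The locale \<open>module\<close> of \<open>HOL-Algebra\<close> requires a commutative ring.\<close>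

locale left_module = R?: ring R + M?: abelian_group M
  for R :: "('r, 'x) ring_scheme" (structure) and M :: "('r, 'm, 'y) module_scheme" (structure) +
  assumes smult_closed:
      "\<lbrakk>r \<in> carrier R; u \<in> carrier M\<rbrakk> \<Longrightarrow> r \<odot>\<^bsub>M\<^esub> u \<in> carrier M"
    and smult_l_distr:
      "\<lbrakk>r \<in> carrier R; s \<in> carrier R; u \<in> carrier M\<rbrakk> \<Longrightarrow>
         (r \<oplus>\<^bsub>R\<^esub> s) \<odot>\<^bsub>M\<^esub> u = r \<odot>\<^bsub>M\<^esub> u \<oplus>\<^bsub>M\<^esub> s \<odot>\<^bsub>M\<^esub> u"
    and smult_r_distr:
      "\<lbrakk>r \<in> carrier R; u \<in> carrier M; v \<in> carrier M\<rbrakk> \<Longrightarrow>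
         r \<odot>\<^bsub>M\<^esub> (u \<oplus>\<^bsub>M\<^esub> v) = r \<odot>\<^bsub>M\<^esub> u \<oplus>\<^bsub>M\<^esub> r \<odot>\<^bsub>M\<^esub> v"
    and smult_assoc:
      "\<lbrakk>r \<in> carrier R; s \<in> carrier R; u \<in> carrier M\<rbrakk> \<Longrightarrow>
         (r \<otimes>\<^bsub>R\<^esub> s) \<odot>\<^bsub>M\<^esub> u = r \<odot>\<^bsub>M\<^esub> (s \<odot>\<^bsub>M\<^esub> u)"
    and smult_one:
      "u \<in> carrier M \<Longrightarrow> \<one>\<^bsub>R\<^esub> \<odot>\<^bsub>M\<^esub> u = u"

datatype 'r module_symbol = Plus | Neg | Zero | Scalar 'r

fun module_arity :: "'r module_symbol \<Rightarrow> nat" where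
  "module_arity Plus = 2"
| "module_arity Neg = 1"
| "module_arity Zero = 0"
| "module_arity (Scalar r) = 1"

fun module_op :: "('r, 'm, 'y) module_scheme \<Rightarrow> 'r module_symbol \<Rightarrow> 'm list \<Rightarrow> 'm" where
  "module_op M Plus us = us ! 0 \<oplus>\<^bsub>M\<^esub> us ! 1"
| "module_op M Neg us = \<ominus>\<^bsub>M\<^esub> (us ! 0)"
| "module_op M Zero us = \<zero>\<^bsub>M\<^esub>"
| "module_op M (Scalar r) us = r \<odot>\<^bsub>M\<^esub> (us ! 0)"

definition module_algebra ::
    "('r, 'x) ring_scheme \<Rightarrow> ('r, 'm, 'y) module_scheme \<Rightarrow> ('r module_symbol, 'm) ualg" where
  "module_algebra R M =
     \<lparr>Universe = carrier M,
      Symbols = {Plus, Neg, Zero} \<union> Scalar ` carrier R,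
      Arity = module_arity,
      Op = module_op M\<rparr>"


section \<open>Dualizability\<close>

text \<open>
  HOL cannot quantify over types inside a formula, so the types of the elements of \<open>B\<close> and of the
  indices of the powers are parameters; the class \<open>SP(A)\<close> is obtained by letting both
  type variables range over all types.
\<close>

definition in_SP :: "'i itself \<Rightarrow> ('f, 'a) ualg \<Rightarrow> ('f, 'b) ualg \<Rightarrow> bool" where
  "in_SP idx A B \<longleftrightarrow> is_algebra B \<and>
     (\<exists>(I :: 'i set) S. subuniverse (power_alg A I) S \<and> S \<noteq> {} \<and>
        isomorphic B (subalg (power_alg A I) S))"

text \<open>
  A relation carries its arity \<open>n\<close>, as \<open>n\<close> cannot be recovered from the
  set of extensional functions alone if \<open>Universe A = {undefined}\<close>.
\<close>

definition compatible_relation :: "('f, 'a) ualg \<Rightarrow> nat \<times> (nat \<Rightarrow> 'a) set \<Rightarrow> bool" where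
  "compatible_relation A = (\<lambda>(n, r). 1 \<le> n \<and> r \<noteq> {} \<and> subuniverse (power_alg A {..<n}) r)"

definition Hom_topology :: "('f, 'b) ualg \<Rightarrow> ('f, 'a) ualg \<Rightarrow> ('b \<Rightarrow> 'a) topology" where
  "Hom_topology B A =
     subtopology (product_topology (\<lambda>_. discrete_topology (Universe A)) (Universe B)) (Hom B A)"

definition preserves ::
    "('f, 'b) ualg \<Rightarrow> ('f, 'a) ualg \<Rightarrow> (('b \<Rightarrow> 'a) \<Rightarrow> 'a) \<Rightarrow> nat \<times> (nat \<Rightarrow> 'a) set \<Rightarrow> bool" where
  "preserves B A \<phi> = (\<lambda>(n, r). \<forall>hs \<in> {..<n} \<rightarrow>\<^sub>E Hom B A.
     (\<forall>b\<in>Universe B. (\<lambda>i\<in>{..<n}. hs i b) \<in> r) \<longrightarrow> (\<lambda>i\<in>{..<n}. \<phi> (hs i)) \<in> r)"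

definition dualized_by ::
    "'b itself \<Rightarrow> 'i itself \<Rightarrow> ('f, 'a) ualg \<Rightarrow> (nat \<times> (nat \<Rightarrow> 'a) set) set \<Rightarrow> bool" where
  "dualized_by elt idx A R \<longleftrightarrow>
     (\<forall>B :: ('f, 'b) ualg. in_SP idx A B \<longrightarrow>
        (\<forall>\<phi>. continuous_map (Hom_topology B A) (discrete_topology (Universe A)) \<phi> \<and>
              (\<forall>\<rho>\<in>R. preserves B A \<phi> \<rho>) \<longrightarrow>
           (\<exists>b\<in>Universe B. \<forall>h\<in>Hom B A. \<phi> h = h b)))"

definition dualizable :: "'b itself \<Rightarrow> 'i itself \<Rightarrow> ('f, 'a) ualg \<Rightarrow> bool" where
  "dualizable elt idx A \<longleftrightarrow>
     (\<exists>R. (\<forall>\<rho>\<in>R. compatible_relation A \<rho>) \<and> dualized_by elt idx A R)"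

text \<open>
  The set \<open>R\<close> can be chosen independently of the type parameters: if any set of
  compatible relations works, then so does the set of all of them, which does not depend on them.
\<close>

lemma dualizable_iff_all_compatible_relations:
  "dualizable elt idx A \<longleftrightarrow> dualized_by elt idx A {\<rho>. compatible_relation A \<rho>}"
proof
  assume "dualizable elt idx A"
  then obtain R where "R \<subseteq> {\<rho>. compatible_relation A \<rho>}" and "dualized_by elt idx A R"
    unfolding dualizable_def by blast
  then show "dualized_by elt idx A {\<rho>. compatible_relation A \<rho>}"
    unfolding dualized_by_def by (meson subsetD)
next
  assume "dualized_by elt idx A {\<rho>. compatible_relation A \<rho>}"
  then show "dualizable elt idx A"
    unfolding dualizable_def by blast
qed

end

theory Submission
  imports Defs "HOL-Number_Theory.Cong" "HOL-Algebra.Multiplicative_Group"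
begin

text \<open>
  Let \<open>\<phi>\<close> be a continuous map on \<open>Hom B A\<close> that preserves all compatible relations of the finite
  affine algebra \<open>A\<close>. For finitely many homomorphisms \<open>h\<^sub>1, \<dots>, h\<^sub>n\<close> the tuples
  \<open>(h\<^sub>1 b, \<dots>, h\<^sub>n b)\<close> with \<open>b\<close> in \<open>B\<close> form a compatible relation, and preserving it means that
  \<open>\<phi>\<close> agrees on these \<open>h\<^sub>i\<close> with the evaluation at some \<open>b\<close> (\<open>finite_interpolation\<close>). The problem is
  to make \<open>b\<close> independent of the finite set. Continuity alone does not achieve this: \<open>\<phi>\<close> depends only on
  the restrictions of homomorphisms to a finite subset of \<open>B\<close>, but the interpolating \<open>b\<close> need not lie
  in that subset.

  The way out is a double annihilator argument in the style of Pontryagin duality. Take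
  homomorphisms \<open>\<chi>\<^sub>a\<close>, indexed by the elements \<open>a\<close> of \<open>A\<close>, from the group of \<open>A\<close> to the integers
  modulo \<open>m\<close>, where \<open>m\<close> is the order of \<open>A\<close>, that together separate points. On the compact space
  \<open>P\<close> of all families \<open>h = (h\<^sub>a)\<close> of homomorphisms from \<open>B\<close> to \<open>A\<close>, the map \<open>\<phi>\<close> is encoded by the
  single function that sends \<open>h\<close> to the sum of the \<open>\<chi>\<^sub>a (\<phi> h\<^sub>a)\<close>, and an element \<open>b\<close> by the sum of
  the \<open>\<chi>\<^sub>a (h\<^sub>a b)\<close>. Conversely, a family that takes the value \<open>h\<close> at one index and a fixed
  homomorphism at all others recovers each \<open>\<chi>\<^sub>a (\<phi> h)\<close> from the first sum, hence also \<open>\<phi>\<close>.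
  So it suffices to find \<open>b\<close> for which the two functions agree.

  Since \<open>B\<close> inherits the term \<open>x - y + z\<close>, the functions that come from elements of \<open>B\<close> are closed
  under \<open>u - v + w\<close>. After normalising at a base point \<open>h0\<close> they form a group of additive functions,
  and the function of \<open>\<phi>\<close> is additive as well. A family \<open>h\<close> has finitely many entries because \<open>A\<close> is
  finite, so interpolation on these entries and \<open>h0\<close> shows that the function of \<open>\<phi>\<close> vanishes at
  every common zero of the functions of \<open>B\<close>. Compactness of \<open>P\<close> reduces this to finitely many
  elements of \<open>B\<close>, and then linear algebra modulo \<open>m\<close>
  (\<open>cong_combination_of_functionals\<close>) writes the function of \<open>\<phi>\<close> as an integer combination of the functions
  of these elements. The combination is itself the function of an element of \<open>B\<close>.

  A module is affine because its operations, hence all its terms, are additive maps, and therefore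
  commute with \<open>x - y + z\<close>.
\<close>

section \<open>Functionals modulo an integer\<close>

text \<open>
  The closure hypothesis says that the pairs \<open>(e x, \<psi> x)\<close> form a subgroup modulo \<open>m\<close>; no group
  structure on \<open>P\<close> itself is fixed, so that the lemma can be applied to subsets of \<open>P\<close> cut out by
  congruences. The values of \<open>e\<close> form a subgroup of the cyclic group of integers modulo
  \<open>m\<close>, generated by some divisor \<open>d\<close> of \<open>m\<close>, say \<open>d = e g\<close>. As \<open>e\<close> kills the multiple \<open>m div d\<close>
  of \<open>g\<close>, so does \<open>\<psi>\<close>, which forces \<open>d\<close> to divide \<open>\<psi> g\<close>. The quotient is the required factor.
\<close>

lemma cong_multiple_of_one_functional:
  fixes m :: int and e \<psi> :: "'p \<Rightarrow> int"
  assumes m: "m > 0"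
    and diff: "\<And>x y. \<lbrakk>x \<in> P; y \<in> P\<rbrakk> \<Longrightarrow>
      \<exists>z\<in>P. [\<psi> z = \<psi> x - \<psi> y] (mod m) \<and> [e z = e x - e y] (mod m)"
    and vanish: "\<And>x. \<lbrakk>x \<in> P; [e x = 0] (mod m)\<rbrakk> \<Longrightarrow> [\<psi> x = 0] (mod m)"
  shows "\<exists>k. \<forall>x\<in>P. [\<psi> x = k * e x] (mod m)"
proof (cases "P = {}")
  case False
  then obtain x0 where x0: "x0 \<in> P" by blast
  have shift: "\<exists>z\<in>P. [\<psi> z = \<psi> x - j * \<psi> y] (mod m) \<and> [e z = e x - j * e y] (mod m)"
    if "x \<in> P" "y \<in> P" for x y j
  proof (induction j rule: int_induct[where k = 0])
    case base
    show ?case using that by (intro bexI[of _ x]) auto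
  next
    case (step1 j)
    then obtain z where z: "z \<in> P" "[\<psi> z = \<psi> x - j * \<psi> y] (mod m)"
        "[e z = e x - j * e y] (mod m)" by blast
    obtain w where w: "w \<in> P" "[\<psi> w = \<psi> z - \<psi> y] (mod m)" "[e w = e z - e y] (mod m)"
      using diff[OF z(1) \<open>y \<in> P\<close>] by blast
    have "[\<psi> w = \<psi> x - j * \<psi> y - \<psi> y] (mod m)" "[e w = e x - j * e y - e y] (mod m)"
      using w z by (meson cong_diff cong_refl cong_trans)+
    then show ?case using w(1) by (intro bexI[of _ w]) (auto simp: algebra_simps)
  next
    case (step2 j)
    then obtain z where z: "z \<in> P" "[\<psi> z = \<psi> x - j * \<psi> y] (mod m)"
        "[e z = e x - j * e y] (mod m)" by blast
    \<comment> \<open>only differences are available, so \<open>z + y\<close> is reached as \<open>z - ((y - y) - y)\<close>\<close>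
    obtain v where v: "v \<in> P" "[\<psi> v = \<psi> y - \<psi> y] (mod m)" "[e v = e y - e y] (mod m)"
      using diff[OF \<open>y \<in> P\<close> \<open>y \<in> P\<close>] by blast
    obtain u where u: "u \<in> P" "[\<psi> u = \<psi> v - \<psi> y] (mod m)" "[e u = e v - e y] (mod m)"
      using diff[OF v(1) \<open>y \<in> P\<close>] by blast
    obtain w where w: "w \<in> P" "[\<psi> w = \<psi> z - \<psi> u] (mod m)" "[e w = e z - e u] (mod m)"
      using diff[OF z(1) u(1)] by blast
    have "[\<psi> w = \<psi> x - j * \<psi> y - (\<psi> y - \<psi> y - \<psi> y)] (mod m)"
        "[e w = e x - j * e y - (e y - e y - e y)] (mod m)"
      using w z u v by (meson cong_diff cong_refl cong_trans)+
    then show ?case using w(1) by (intro bexI[of _ w]) (auto simp: algebra_simps)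
  qed
  \<comment> \<open>the least positive value of \<open>e\<close> modulo \<open>m\<close>, with \<open>m\<close> admitted as a form of \<open>0\<close>, is the generator\<close>
  define good where "good n \<longleftrightarrow> n > 0 \<and> (\<exists>x\<in>P. [e x = int n] (mod m))" for n
  have "good (nat (e x0 mod m + m))"
    using x0 m by (auto simp: good_def cong_def intro!: bexI[of _ x0] add_nonneg_pos)
  then have good: "good (LEAST n. good n)" by (rule LeastI)
  define d where "d = int (LEAST n. good n)"
  obtain g where d: "d > 0" and g: "g \<in> P" "[e g = d] (mod m)"
    using good by (auto simp: good_def d_def)
  have least: "r = 0" if "r \<ge> 0" "r < d" "x \<in> P" "[e x = r] (mod m)" for r x
  proof (rule ccontr)
    assume "r \<noteq> 0"
    then have "good (nat r)" using that by (auto simp: good_def)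
    then have "d \<le> int (nat r)" unfolding d_def by (intro of_nat_mono Least_le)
    then show False using that by simp
  qed
  have mult: "\<exists>z\<in>P. [\<psi> z = \<psi> x - t * \<psi> g] (mod m) \<and> [e z = e x - t * d] (mod m)"
    if "x \<in> P" for x t
    using shift[OF that g(1), of t] g(2) by (meson cong_diff cong_mult cong_refl cong_trans)
  \<comment> \<open>applied to \<open>n = m\<close> at a zero of \<open>e\<close>, this also gives that \<open>d\<close> divides \<open>m\<close>\<close>
  have dvd: "d dvd n" if x: "x \<in> P" "[e x = n] (mod m)" for x n
  proof -
    obtain z where z: "z \<in> P" "[e z = e x - (n div d) * d] (mod m)"
      using mult[OF x(1)] by blast
    then have "[e z = n - (n div d) * d] (mod m)"
      using x(2) by (meson cong_diff cong_refl cong_trans)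
    then have "n mod d = 0"
      using least[of "n mod d" z] d z(1) by (simp add: minus_div_mult_eq_mod)
    then show ?thesis by auto
  qed
  obtain z0 where z0: "z0 \<in> P" "[\<psi> z0 = \<psi> g - 1 * \<psi> g] (mod m)" "[e z0 = e g - 1 * d] (mod m)"
    using mult[OF g(1), of 1] by blast
  have "[e g - 1 * d = 0] (mod m)"
    using g(2) by (simp add: cong_diff_iff_cong_0)
  with z0(3) have e0: "[e z0 = 0] (mod m)" by (rule cong_trans)
  then have "[e z0 = m] (mod m)" by (simp add: cong_def)
  from dvd[OF z0(1) this] have "d dvd m" .
  then obtain c where c: "m = c * d" by (auto simp: dvd_def mult.commute)
  obtain y where y: "y \<in> P" "[\<psi> y = \<psi> z0 - c * \<psi> g] (mod m)" "[e y = e z0 - c * d] (mod m)"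
    using mult[OF z0(1)] by blast
  have "[e z0 - c * d = 0 - 0] (mod m)"
    using e0 c by (intro cong_diff) (auto simp: cong_def)
  with y(3) have "[e y = 0] (mod m)" using cong_trans by fastforce
  with vanish[OF y(1)] have "[\<psi> y = 0] (mod m)" .
  moreover have "[\<psi> z0 = 0] (mod m)" using z0(2) by simp
  ultimately have "[\<psi> z0 - (\<psi> z0 - c * \<psi> g) = 0 - 0] (mod m)"
    using y(2) by (intro cong_diff) (auto intro: cong_sym cong_trans)
  then have "m dvd c * \<psi> g" by (simp add: cong_0_iff)
  then have "d dvd \<psi> g" using c m by auto
  then obtain k where k: "\<psi> g = k * d" by (auto simp: dvd_def mult.commute)
  have "[\<psi> x = k * e x] (mod m)" if x: "x \<in> P" for x
  proof -
    obtain q where q: "e x = q * d" using dvd[OF x cong_refl] by (auto simp: dvd_def mult.commute)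
    obtain z where z: "z \<in> P" "[\<psi> z = \<psi> x - q * \<psi> g] (mod m)" "[e z = e x - q * d] (mod m)"
      using mult[OF x] by blast
    have "[\<psi> z = 0] (mod m)" using vanish[OF z(1)] z(3) q by simp
    then have "[\<psi> x = q * \<psi> g] (mod m)"
      using z(2) by (metis cong_diff_iff_cong_0 cong_sym cong_trans)
    then show ?thesis by (simp add: k q ac_simps)
  qed
  then show ?thesis by blast
qed simp

text \<open>
  The double annihilator theorem for functionals modulo \<open>m\<close>. In the induction step the claim for
  \<open>I\<close> is applied on the zero set of \<open>f i\<close>; subtracting the combination found there leaves a function
  that vanishes on this zero set, hence is a multiple of \<open>f i\<close>.
\<close>

lemma cong_combination_of_functionals:
  fixes m :: int and f :: "'i \<Rightarrow> 'p \<Rightarrow> int" and \<psi> :: "'p \<Rightarrow> int"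
  assumes "m > 0" and "finite I"
    and "\<And>x y. \<lbrakk>x \<in> P; y \<in> P\<rbrakk> \<Longrightarrow>
      \<exists>z\<in>P. [\<psi> z = \<psi> x - \<psi> y] (mod m) \<and> (\<forall>i\<in>I. [f i z = f i x - f i y] (mod m))"
    and "\<And>x. \<lbrakk>x \<in> P; \<forall>i\<in>I. [f i x = 0] (mod m)\<rbrakk> \<Longrightarrow> [\<psi> x = 0] (mod m)"
  shows "\<exists>k. \<forall>x\<in>P. [\<psi> x = (\<Sum>i\<in>I. k i * f i x)] (mod m)"
  using assms(2-4)
proof (induction I arbitrary: P)
  case empty
  then show ?case by auto
next
  case (insert i I)
  let ?P = "{x \<in> P. [f i x = 0] (mod m)}"
  have "\<exists>k. \<forall>x\<in>?P. [\<psi> x = (\<Sum>i\<in>I. k i * f i x)] (mod m)"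
  proof (rule insert.IH)
    fix x y assume xy: "x \<in> ?P" "y \<in> ?P"
    then obtain z where z: "z \<in> P" "[\<psi> z = \<psi> x - \<psi> y] (mod m)"
        "\<forall>j\<in>insert i I. [f j z = f j x - f j y] (mod m)"
      using insert.prems(1)[of x y] by blast
    have "[f i x - f i y = 0 - 0] (mod m)"
      using xy by (intro cong_diff) auto
    then have "[f i z = 0] (mod m)" using z(3) by (metis cong_trans diff_0_right insertI1)
    with z show "\<exists>z\<in>?P. [\<psi> z = \<psi> x - \<psi> y] (mod m) \<and> (\<forall>i\<in>I. [f i z = f i x - f i y] (mod m))"
      by blast
  next
    fix x assume "x \<in> ?P" "\<forall>i\<in>I. [f i x = 0] (mod m)"
    then show "[\<psi> x = 0] (mod m)" using insert.prems(2)[of x] by blast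
  qed
  then obtain k where k: "\<And>x. \<lbrakk>x \<in> P; [f i x = 0] (mod m)\<rbrakk> \<Longrightarrow> [\<psi> x = (\<Sum>i\<in>I. k i * f i x)] (mod m)"
    by blast
  define s where "s x = (\<Sum>i\<in>I. k i * f i x)" for x
  have "\<exists>c. \<forall>x\<in>P. [\<psi> x - s x = c * f i x] (mod m)"
  proof (rule cong_multiple_of_one_functional[OF assms(1)])
    fix x y assume xy: "x \<in> P" "y \<in> P"
    obtain z where z: "z \<in> P" "[\<psi> z = \<psi> x - \<psi> y] (mod m)"
        "\<forall>j\<in>insert i I. [f j z = f j x - f j y] (mod m)"
      using insert.prems(1)[OF xy] by blast
    have "[s z = (\<Sum>i\<in>I. k i * (f i x - f i y))] (mod m)"
      unfolding s_def using z(3) by (intro cong_sum cong_mult) auto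
    then have "[s z = s x - s y] (mod m)"
      by (simp add: s_def algebra_simps sum_subtractf)
    with z(2) have "[\<psi> z - s z = (\<psi> x - \<psi> y) - (s x - s y)] (mod m)"
      by (rule cong_diff)
    then show "\<exists>z\<in>P. [\<psi> z - s z = (\<psi> x - s x) - (\<psi> y - s y)] (mod m) \<and>
        [f i z = f i x - f i y] (mod m)"
      using z by (intro bexI[of _ z]) (auto simp: algebra_simps)
  next
    fix x assume "x \<in> P" "[f i x = 0] (mod m)"
    then show "[\<psi> x - s x = 0] (mod m)"
      using k[of x] by (simp add: s_def cong_diff_iff_cong_0)
  qed
  then obtain c where c: "\<And>x. x \<in> P \<Longrightarrow> [\<psi> x - s x = c * f i x] (mod m)" by blast
  have "[\<psi> x = (\<Sum>j\<in>insert i I. (k(i := c)) j * f j x)] (mod m)" if "x \<in> P" for x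
  proof -
    have "(\<Sum>j\<in>insert i I. (k(i := c)) j * f j x) = c * f i x + s x"
      using insert.hyps unfolding s_def
      by (subst sum.insert) (auto intro!: sum.cong arg_cong2[where f = "(+)"])
    then show ?thesis using c[OF that] by (simp add: cong_iff_dvd_diff algebra_simps)
  qed
  then show ?case by blast
qed


section \<open>Characters of finite abelian groups\<close>

text \<open>
  This is again the double annihilator theorem, now on the space of all functions \<open>\<chi>\<close> from the group to the
  integers. The characters are the common zeros of the functionals
  \<open>\<chi> (x \<oplus> y) - \<chi> x - \<chi> y\<close>. If all of them vanished at \<open>a\<close>, then evaluation at \<open>a\<close> would be a
  combination of these functionals modulo \<open>m\<close>. Reading functionals as formal sums of group
  elements and evaluating the sums in the group turns every \<open>\<chi> (x \<oplus> y) - \<chi> x - \<chi> y\<close> into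
  \<open>(x \<oplus> y) \<ominus> x \<ominus> y = \<zero>\<close>, and so yields \<open>a = \<zero>\<close>.
\<close>

lemma (in abelian_group) separating_character:
  assumes fin: "finite (carrier G)" and a: "a \<in> carrier G" "a \<noteq> \<zero>"
  shows "\<exists>\<chi> :: 'a \<Rightarrow> int.
    (\<forall>x\<in>carrier G. \<forall>y\<in>carrier G. [\<chi> (x \<oplus> y) = \<chi> x + \<chi> y] (mod int (card (carrier G)))) \<and>
    \<not> [\<chi> a = 0] (mod int (card (carrier G)))"
proof (rule ccontr)
  let ?m = "int (card (carrier G))"
  assume none: "\<nexists>\<chi> :: 'a \<Rightarrow> int.
    (\<forall>x\<in>carrier G. \<forall>y\<in>carrier G. [\<chi> (x \<oplus> y) = \<chi> x + \<chi> y] (mod ?m)) \<and> \<not> [\<chi> a = 0] (mod ?m)"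
  have m: "?m > 0" using fin a by (simp add: card_gt_0_iff) blast
  define rel where "rel = (\<lambda>(x, y) (\<chi> :: 'a \<Rightarrow> int). \<chi> (x \<oplus> y) - \<chi> x - \<chi> y)"
  have "\<exists>k. \<forall>\<chi>\<in>UNIV. [\<chi> a = (\<Sum>p\<in>carrier G \<times> carrier G. k p * rel p \<chi>)] (mod ?m)"
  proof (rule cong_combination_of_functionals[OF m])
    show "finite (carrier G \<times> carrier G)" using fin by simp
  next
    fix \<chi> \<chi>' :: "'a \<Rightarrow> int"
    show "\<exists>\<xi>\<in>UNIV. [\<xi> a = \<chi> a - \<chi>' a] (mod ?m) \<and>
        (\<forall>p\<in>carrier G \<times> carrier G. [rel p \<xi> = rel p \<chi> - rel p \<chi>'] (mod ?m))"
      by (rule bexI[of _ "\<lambda>z. \<chi> z - \<chi>' z"]) (auto simp: rel_def algebra_simps)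
  next
    fix \<chi> :: "'a \<Rightarrow> int"
    assume "\<forall>p\<in>carrier G \<times> carrier G. [rel p \<chi> = 0] (mod ?m)"
    then have "\<forall>x\<in>carrier G. \<forall>y\<in>carrier G. [\<chi> (x \<oplus> y) = \<chi> x + \<chi> y] (mod ?m)"
      by (auto simp: rel_def cong_iff_dvd_diff diff_diff_eq)
    then show "[\<chi> a = 0] (mod ?m)" using none by blast
  qed
  then obtain k where k: "\<And>\<chi> :: 'a \<Rightarrow> int.
      [\<chi> a = (\<Sum>p\<in>carrier G \<times> carrier G. k p * rel p \<chi>)] (mod ?m)" by blast
  \<comment> \<open>the value in the group of a formal sum with coefficients \<open>v\<close>\<close>
  define L where "L v = (\<Oplus>z\<in>carrier G. [(v z :: int)] \<cdot> z)" for v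
  define \<delta> where "\<delta> x z = (if x = z then 1 else 0 :: int)" for x z :: 'a
  have pow_0: "[(0 :: int)] \<cdot> z = \<zero>" for z
    by (simp add: add_pow_def)
  have L_closed [simp]: "L v \<in> carrier G" for v
    unfolding L_def by (intro finsum_closed) auto
  have L_add: "L (\<lambda>z. v z + w z) = L v \<oplus> L w" for v w
  proof -
    have "L (\<lambda>z. v z + w z) = (\<Oplus>z\<in>carrier G. [(v z)] \<cdot> z \<oplus> [(w z)] \<cdot> z)"
      unfolding L_def by (intro finsum_cong') (auto simp: add.int_pow_mult)
    also have "\<dots> = L v \<oplus> L w"
      unfolding L_def by (intro finsum_addf) auto
    finally show ?thesis .
  qed
  have L_zero: "L (\<lambda>z. 0) = \<zero>"
  proof -
    have "L (\<lambda>z. 0) = (\<Oplus>z\<in>carrier G. \<zero>)"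
      unfolding L_def by (intro finsum_cong') (auto simp: pow_0)
    then show ?thesis by simp
  qed
  have L_\<delta>: "L (\<delta> x) = x" if x: "x \<in> carrier G" for x
  proof -
    have "L (\<delta> x) = (\<Oplus>z\<in>carrier G. if x = z then z else \<zero>)"
      unfolding L_def \<delta>_def by (intro finsum_cong') (auto simp: pow_0)
    then show ?thesis using x fin by (simp add: finsum_singleton)
  qed
  have ker_uminus: "L (\<lambda>z. - v z) = \<zero>" if "L v = \<zero>" for v
    using L_add[of v "\<lambda>z. - v z"] that by (simp add: L_zero)
  have ker_scale: "L (\<lambda>z. c * v z) = \<zero>" if v: "L v = \<zero>" for v c
  proof (induction c rule: int_induct[where k = 0])
    case base
    show ?case by (simp add: L_zero)
  next
    case (step1 i)
    then show ?case using L_add[of "\<lambda>z. i * v z" v] v by (simp add: algebra_simps)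
  next
    case (step2 i)
    then show ?case using L_add[of "\<lambda>z. i * v z" "\<lambda>z. - v z"] ker_uminus[OF v]
      by (simp add: algebra_simps)
  qed
  have ker_rel: "L (\<lambda>z. rel p (\<lambda>u. \<delta> z u)) = \<zero>" if mem: "p \<in> carrier G \<times> carrier G" for p
  proof -
    obtain x y where p: "p = (x, y)" and x: "x \<in> carrier G" and y: "y \<in> carrier G"
      using mem by blast
    let ?r = "\<lambda>z. rel p (\<lambda>u. \<delta> z u)"
    have "L (\<lambda>z. ?r z + (\<delta> x z + \<delta> y z)) = L ?r \<oplus> (x \<oplus> y)"
      using x y by (simp add: L_add L_\<delta>)
    moreover have "(\<lambda>z. ?r z + (\<delta> x z + \<delta> y z)) = \<delta> (x \<oplus> y)"
      by (auto simp: fun_eq_iff rel_def p \<delta>_def)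
    ultimately have "L ?r \<oplus> (x \<oplus> y) = x \<oplus> y"
      using x y by (simp add: L_\<delta>)
    then show ?thesis
      using x y by (metis L_closed a_closed add.r_cancel_one)
  qed
  have ker_sum: "L (\<lambda>z. \<Sum>p\<in>S. k p * rel p (\<lambda>u. \<delta> z u)) = \<zero>"
    if "finite S" "S \<subseteq> carrier G \<times> carrier G" for S
    using that
  proof (induction S)
    case empty
    then show ?case by (simp add: L_zero)
  next
    case (insert p S)
    then show ?case using ker_scale[OF ker_rel, of p "k p"] by (simp add: L_add)
  qed
  have ker_m: "L (\<lambda>z. ?m * w z) = \<zero>" for w
  proof -
    have "[(?m * w z)] \<cdot> z = \<zero>" if z: "z \<in> carrier G" for z
    proof -
      have "z [^]\<^bsub>add_monoid G\<^esub> card (carrier G) = \<one>\<^bsub>add_monoid G\<^esub>"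
        using group.pow_order_eq_1[OF a_group, of z] z by (simp add: order_def)
      then have "z [^]\<^bsub>add_monoid G\<^esub> ?m = \<one>\<^bsub>add_monoid G\<^esub>"
        by (simp add: int_pow_int)
      then have "z [^]\<^bsub>add_monoid G\<^esub> (?m * w z) = \<one>\<^bsub>add_monoid G\<^esub>"
        using group.int_pow_pow[OF a_group, of z ?m "w z"] z group.int_pow_one[OF a_group, of "w z"]
        by simp
      then show ?thesis by (simp add: add_pow_def)
    qed
    then have "L (\<lambda>z. ?m * w z) = (\<Oplus>z\<in>carrier G. \<zero>)"
      unfolding L_def by (intro finsum_cong') (auto simp: pow_0)
    then show ?thesis by simp
  qed
  define s where "s z = (\<Sum>p\<in>carrier G \<times> carrier G. k p * rel p (\<lambda>u. \<delta> z u))" for z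
  have "?m dvd \<delta> a z - s z" for z
  proof -
    have "[\<delta> z a = s z] (mod ?m)" using k[of "\<delta> z"] unfolding s_def .
    moreover have "\<delta> z a = \<delta> a z" by (simp add: \<delta>_def)
    ultimately show ?thesis by (simp add: cong_iff_dvd_diff)
  qed
  then have "\<delta> a = (\<lambda>z. ?m * ((\<delta> a z - s z) div ?m) + s z)"
    by (simp add: fun_eq_iff dvd_mult_div_cancel)
  then have "L (\<delta> a) = \<zero> \<oplus> \<zero>"
    using ker_m[of "\<lambda>z. (\<delta> a z - s z) div ?m"] ker_sum[of "carrier G \<times> carrier G"] fin
      L_add[of "\<lambda>z. ?m * ((\<delta> a z - s z) div ?m)" s]
    unfolding s_def by simp
  then show False using a by (simp add: L_\<delta>)
qed


section \<open>Terms and homomorphisms\<close>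

lemma HomD:
  assumes "h \<in> Hom B A"
  shows Hom_mem: "b \<in> Universe B \<Longrightarrow> h b \<in> Universe A"
    and Hom_extensional: "h \<in> extensional (Universe B)"
    and Hom_op: "\<lbrakk>f \<in> Symbols B; xs \<in> args B f (Universe B)\<rbrakk> \<Longrightarrow> h (Op B f xs) = Op A f (map h xs)"
  using assms by (auto simp: Hom_def PiE_def Pi_def)

lemma wf_term_similar:
  assumes "similar B A"
  shows "wf_term B n t \<longleftrightarrow> wf_term A n t"
  using assms by (induction t) (auto simp: similar_def)

lemma eval_term_cong:
  assumes "wf_term A n t" and "\<And>i. i < n \<Longrightarrow> x i = y i"
  shows "eval_term A x t = eval_term A y t"
  using assms(1)
proof (induction t)
  case (App f ts)
  then have "map (eval_term A x) ts = map (eval_term A y) ts" by auto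
  then show ?case by (simp only: eval_term.simps)
qed (simp add: assms(2))

lemma eval_term_closed:
  assumes "closed_under_ops A S" and "wf_term A n t" and "\<And>i. i < n \<Longrightarrow> x i \<in> S"
  shows "eval_term A x t \<in> S"
  using assms(2)
proof (induction t)
  case (App f ts)
  then have "map (eval_term A x) ts \<in> args A f S" by (auto simp: args_def)
  with App.prems assms(1) show ?case by (simp add: closed_under_ops_def)
qed (simp add: assms(3))

text \<open>
  This lets the term that defines \<open>x - y + z\<close> on \<open>A\<close> act on \<open>B\<close> as well.
\<close>

lemma Hom_eval_term:
  assumes alg: "is_algebra B" and wf: "wf_term B n t" and x: "\<And>i. i < n \<Longrightarrow> x i \<in> Universe B"
    and h: "h \<in> Hom B A"
  shows "h (eval_term B x t) = eval_term A (\<lambda>i. h (x i)) t"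
  using wf
proof (induction t)
  case (App f ts)
  have "eval_term B x t \<in> Universe B" if "t \<in> set ts" for t
    using alg App.prems that x by (auto simp: is_algebra_def intro!: eval_term_closed[where n = n])
  then have "map (eval_term B x) ts \<in> args B f (Universe B)"
    using App.prems by (auto simp: args_def)
  then have "h (eval_term B x (App f ts)) = Op A f (map h (map (eval_term B x) ts))"
    using App.prems Hom_op[OF h] by simp
  also have "map h (map (eval_term B x) ts) = map (eval_term A (\<lambda>i. h (x i))) ts"
    using App by auto
  finally show ?case by simp
qed simp


section \<open>Interpolation on finitely many homomorphisms\<close>

text \<open>
  The relation to preserve is the image of \<open>B\<close> under the tuple of the members of \<open>H\<close>. It is a
  subuniverse because it is the image of a homomorphism. The tuple of the members of \<open>H\<close> lies pointwise in it by
  construction, so the tuple of their images under \<open>\<phi>\<close> is one of its elements.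
\<close>

lemma finite_interpolation:
  assumes sim: "similar B A" and alg: "is_algebra B"
    and pres: "\<And>\<rho>. compatible_relation A \<rho> \<Longrightarrow> preserves B A \<phi> \<rho>"
    and H: "finite H" "H \<subseteq> Hom B A"
  shows "\<exists>b\<in>Universe B. \<forall>h\<in>H. \<phi> h = h b"
proof (cases "H = {}")
  case True
  then show ?thesis using alg by (auto simp: is_algebra_def)
next
  case False
  let ?n = "card H"
  obtain hs where hs: "bij_betw hs {..<?n} H"
    using ex_bij_betw_nat_finite[OF H(1)] by (auto simp: atLeast0LessThan)
  have hsH: "hs i \<in> Hom B A" if "i < ?n" for i
    using hs H(2) that by (auto simp: bij_betw_def)
  define tup where "tup b = (\<lambda>i\<in>{..<?n}. hs i b)" for b
  define r where "r = tup ` Universe B"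
  have "closed_under_ops (power_alg A {..<?n}) r"
    unfolding closed_under_ops_def
  proof (intro ballI)
    fix f xs assume f: "f \<in> Symbols (power_alg A {..<?n})"
      and xs: "xs \<in> args (power_alg A {..<?n}) f r"
    have fB: "f \<in> Symbols B" and ar: "Arity B f = Arity A f"
      using f sim by (auto simp: power_alg_def similar_def)
    define bs where "bs = map (inv_into (Universe B) tup) xs"
    have bs: "bs \<in> args B f (Universe B)"
      using xs ar by (auto simp: bs_def args_def power_alg_def r_def intro!: inv_into_into)
    have xs_eq: "xs = map tup bs"
      using xs by (auto simp: bs_def args_def r_def f_inv_into_f subset_iff intro!: map_idI[symmetric])
    have "Op (power_alg A {..<?n}) f xs = tup (Op B f bs)"
      unfolding xs_eq tup_def power_alg_def using Hom_op[OF hsH fB bs]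
      by (auto simp: fun_eq_iff o_def cong: map_cong)
    moreover have "Op B f bs \<in> Universe B"
      using alg fB bs by (auto simp: is_algebra_def closed_under_ops_def)
    ultimately show "Op (power_alg A {..<?n}) f xs \<in> r" by (simp add: r_def)
  qed
  moreover have "tup b \<in> {..<?n} \<rightarrow>\<^sub>E Universe A" if b: "b \<in> Universe B" for b
    unfolding tup_def restrict_PiE_iff using Hom_mem[OF hsH b] by simp
  then have "r \<subseteq> Universe (power_alg A {..<?n})"
    by (auto simp: r_def power_alg_def)
  moreover have "r \<noteq> {}" using alg by (auto simp: r_def is_algebra_def)
  moreover have "1 \<le> ?n" using False H(1) by (simp add: Suc_le_eq card_gt_0_iff)
  ultimately have "preserves B A \<phi> (?n, r)"
    by (intro pres) (simp add: compatible_relation_def subuniverse_def)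
  moreover have "restrict hs {..<?n} \<in> {..<?n} \<rightarrow>\<^sub>E Hom B A" using hsH by auto
  moreover have "(\<lambda>i\<in>{..<?n}. restrict hs {..<?n} i b) \<in> r" if "b \<in> Universe B" for b
  proof -
    have "(\<lambda>i\<in>{..<?n}. restrict hs {..<?n} i b) = tup b"
      by (auto simp: tup_def fun_eq_iff)
    then show ?thesis using that by (simp add: r_def)
  qed
  ultimately have "(\<lambda>i\<in>{..<?n}. \<phi> (restrict hs {..<?n} i)) \<in> r"
    unfolding preserves_def by blast
  then obtain b where b: "b \<in> Universe B"
    and eq: "(\<lambda>i\<in>{..<?n}. \<phi> (restrict hs {..<?n} i)) = tup b"
    by (auto simp: r_def)
  have "\<phi> (hs i) = hs i b" if "i < ?n" for i
    using fun_cong[OF eq, of i] that by (simp add: tup_def)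
  moreover have "\<exists>i<?n. h = hs i" if "h \<in> H" for h
    using hs that by (auto simp: bij_betw_def)
  ultimately have "\<forall>h\<in>H. \<phi> h = h b" by auto
  with b show ?thesis by blast
qed


section \<open>Compactness of spaces of homomorphisms\<close>

text \<open>
  Near any point both functions are constant, so it does not matter which function \<open>q\<close> combines
  them. The discrete codomain is enlarged to the whole type so that combinations can be iterated.
\<close>

lemma continuous_map_discrete_combine:
  assumes "continuous_map T (discrete_topology U) f" and "continuous_map T (discrete_topology V) g"
  shows "continuous_map T (discrete_topology UNIV) (\<lambda>x. q (f x) (g x))"
proof -
  have "openin T {x \<in> topspace T. q (f x) (g x) \<in> W}" for W
  proof -
    let ?N = "\<lambda>y. {x \<in> topspace T. f x \<in> {f y}} \<inter> {x \<in> topspace T. g x \<in> {g y}}"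
    have "openin T (?N y)" if "y \<in> topspace T" for y
    proof (intro openin_Int)
      have "f y \<in> U" "g y \<in> V"
        using assms that by (auto simp: continuous_map_def)
      then show "openin T {x \<in> topspace T. f x \<in> {f y}}" "openin T {x \<in> topspace T. g x \<in> {g y}}"
        using openin_continuous_map_preimage[OF assms(1), of "{f y}"]
          openin_continuous_map_preimage[OF assms(2), of "{g y}"] by simp_all
    qed
    then have "openin T (\<Union>y\<in>{y \<in> topspace T. q (f y) (g y) \<in> W}. ?N y)"
      by (intro openin_Union) blast
    moreover have "{x \<in> topspace T. q (f x) (g x) \<in> W} =
        (\<Union>y\<in>{y \<in> topspace T. q (f y) (g y) \<in> W}. ?N y)" by auto
    ultimately show ?thesis by (simp only:)
  qed
  then show ?thesis by (auto simp: continuous_map_def)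
qed

lemma continuous_map_discrete_compose:
  assumes "continuous_map T (discrete_topology U) f"
  shows "continuous_map T (discrete_topology UNIV) (\<lambda>x. q (f x))"
  using continuous_map_discrete_combine[OF assms assms, of "\<lambda>x _. q x"] .

lemma continuous_map_discrete_sum:
  assumes "\<And>i. i \<in> I \<Longrightarrow> continuous_map T (discrete_topology UNIV) (f i)"
  shows "continuous_map T (discrete_topology UNIV) (\<lambda>x. \<Sum>i\<in>I. f i x)"
  using assms
proof (induction I rule: infinite_finite_induct)
  case (insert i I)
  then show ?case
    using continuous_map_discrete_combine[of T UNIV "f i" UNIV _ "(+)"] by simp
qed auto

lemma compact_space_finite_subcover:
  assumes "compact_space T" and "openin T V" and "\<And>i. i \<in> I \<Longrightarrow> openin T (U i)"
    and "topspace T \<subseteq> V \<union> (\<Union>i\<in>I. U i)"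
  obtains F where "finite F" "F \<subseteq> I" "topspace T \<subseteq> V \<union> (\<Union>i\<in>F. U i)"
proof -
  have "\<forall>W\<in>insert V (U ` I). openin T W" "topspace T \<subseteq> \<Union> (insert V (U ` I))"
    using assms by auto
  then obtain \<F> where \<F>: "finite \<F>" "\<F> \<subseteq> insert V (U ` I)" "topspace T \<subseteq> \<Union> \<F>"
    using assms(1) unfolding compact_space_alt by meson
  have "finite (\<F> - {V})" "\<F> - {V} \<subseteq> U ` I" using \<F> by auto
  then obtain F where F: "finite F" "F \<subseteq> I" "\<F> - {V} = U ` F"
    by (metis finite_subset_image)
  have "topspace T \<subseteq> V \<union> \<Union> (\<F> - {V})" using \<F>(3) by blast
  then show ?thesis using that[OF F(1,2)] F(3) by simp
qed

text \<open>
  The homomorphisms are closed in the compact power of \<open>A\<close>: a violated homomorphism condition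
  involves only finitely many coordinates, hence stays violated nearby.
\<close>

lemma compact_space_Hom_topology:
  assumes sim: "similar B A" and alg: "is_algebra B" and fin: "finite (Universe A)"
  shows "compact_space (Hom_topology B A)"
proof -
  let ?T = "product_topology (\<lambda>_. discrete_topology (Universe A)) (Universe B)"
  have compact: "compact_space ?T"
    using fin by (simp add: compact_space_product_topology compact_space_discrete_topology)
  have coord: "continuous_map ?T (discrete_topology UNIV) (\<lambda>h. h b)" if "b \<in> Universe B" for b
    using continuous_map_discrete_compose[OF continuous_map_product_projection[OF that], of _ "\<lambda>a. a"] .
  have coords: "continuous_map ?T (discrete_topology UNIV) (\<lambda>h. map h xs)"
    if "set xs \<subseteq> Universe B" for xs
    using that
  proof (induction xs)
    case (Cons b xs)
    then show ?case
      using continuous_map_discrete_combine[OF coord[of b], of UNIV "\<lambda>h. map h xs" "(#)"] by simp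
  qed auto
  let ?bad = "\<lambda>f xs. {h \<in> topspace ?T. (h (Op B f xs) \<noteq> Op A f (map h xs)) \<in> {True}}"
  have bad: "openin ?T (?bad f xs)"
    if "f \<in> Symbols B" "xs \<in> args B f (Universe B)" for f xs
  proof (rule openin_continuous_map_preimage)
    have "Op B f xs \<in> Universe B"
      using alg that by (auto simp: is_algebra_def closed_under_ops_def)
    then show "continuous_map ?T (discrete_topology UNIV) (\<lambda>h. h (Op B f xs) \<noteq> Op A f (map h xs))"
      using that continuous_map_discrete_combine[OF coord coords, of "Op B f xs" xs "\<lambda>a as. a \<noteq> Op A f as"]
      by (simp add: args_def)
  qed simp
  have "topspace ?T - Hom B A = (\<Union>f\<in>Symbols B. \<Union>xs\<in>args B f (Universe B). ?bad f xs)"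
    by (auto simp: Hom_def)
  moreover have "openin ?T \<dots>"
    using bad by (intro openin_Union) auto
  ultimately have "closedin ?T (Hom B A)"
    by (auto simp: closedin_def Hom_def)
  then show ?thesis
    unfolding Hom_topology_def
    by (intro compact_space_subtopology closedin_compact_space[OF compact])
qed

lemma topspace_Hom_topology: "topspace (Hom_topology B A) = Hom B A"
  by (auto simp: Hom_topology_def Hom_def)

lemma continuous_map_Hom_eval:
  assumes "b \<in> Universe B"
  shows "continuous_map (Hom_topology B A) (discrete_topology (Universe A)) (\<lambda>h. h b)"
  unfolding Hom_topology_def
  by (intro continuous_map_from_subtopology continuous_map_product_projection assms)


section \<open>Affine algebras\<close>

text \<open>
  In the definition of affine algebras the group is existentially quantified; here it is fixed.
\<close>

locale affine_structure = abelian_group G for G :: "'a ring" (structure) +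
  fixes A :: "('f, 'a) ualg"
  assumes carrier_eq: "carrier G = Universe A"
    and ternary: "term_operation A 3 (\<lambda>x. x 0 \<ominus> x 1 \<oplus> x 2)"
    and commute: "\<lbrakk>term_operation A n t; x \<in> {..<n} \<rightarrow>\<^sub>E Universe A; y \<in> {..<n} \<rightarrow>\<^sub>E Universe A;
        z \<in> {..<n} \<rightarrow>\<^sub>E Universe A\<rbrakk> \<Longrightarrow>
      t (\<lambda>i\<in>{..<n}. x i \<ominus> y i \<oplus> z i) = t x \<ominus> t y \<oplus> t z"

context affine_structure
begin

lemma op_commute:
  fixes bs :: "'b list"
  assumes f: "f \<in> Symbols A"
    and "length bs = Arity A f"
    and h: "\<And>b. b \<in> set bs \<Longrightarrow> h b \<in> Universe A" "\<And>b. b \<in> set bs \<Longrightarrow> h' b \<in> Universe A"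
      "\<And>b. b \<in> set bs \<Longrightarrow> h'' b \<in> Universe A"
  shows "Op A f (map (\<lambda>b. h b \<ominus> h' b \<oplus> h'' b) bs) =
    Op A f (map h bs) \<ominus> Op A f (map h' bs) \<oplus> Op A f (map h'' bs)"
proof -
  let ?n = "Arity A f"
  let ?tup = "\<lambda>g. \<lambda>i\<in>{..<?n}. g (bs ! i)"
  let ?t = "\<lambda>x. Op A f (map x [0..<?n])"
  have map_tup: "map (?tup g) [0..<?n] = map g bs" for g :: "'b \<Rightarrow> 'a"
    using assms(2) by (auto intro!: nth_equalityI)
  have "term_operation A ?n ?t"
    unfolding term_operation_def
    using f by (intro exI[of _ "App f (map Var [0..<?n])"]) (auto simp: o_def cong: map_cong)
  from commute[OF this, of "?tup h" "?tup h'" "?tup h''"]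
  have "?t (\<lambda>i\<in>{..<?n}. ?tup h i \<ominus> ?tup h' i \<oplus> ?tup h'' i) =
      ?t (?tup h) \<ominus> ?t (?tup h') \<oplus> ?t (?tup h'')"
    using assms by auto
  moreover have "(\<lambda>i\<in>{..<?n}. ?tup h i \<ominus> ?tup h' i \<oplus> ?tup h'' i) =
      ?tup (\<lambda>b. h b \<ominus> h' b \<oplus> h'' b)"
    by (auto simp: fun_eq_iff)
  ultimately have "?t (?tup (\<lambda>b. h b \<ominus> h' b \<oplus> h'' b)) =
      ?t (?tup h) \<ominus> ?t (?tup h') \<oplus> ?t (?tup h'')"
    by (simp only:)
  then show ?thesis
    unfolding map_tup[of h] map_tup[of h'] map_tup[of h''] map_tup[of "\<lambda>b. h b \<ominus> h' b \<oplus> h'' b"] .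
qed

text \<open>
  Homomorphisms are closed under \<open>h - h' + h''\<close> because the basic operations, being term operations,
  commute with it.
\<close>

lemma Hom_ternary:
  assumes sim: "similar B A" and alg: "is_algebra B"
    and h: "h \<in> Hom B A" "h' \<in> Hom B A" "h'' \<in> Hom B A"
  shows "(\<lambda>b\<in>Universe B. h b \<ominus> h' b \<oplus> h'' b) \<in> Hom B A" (is "?g \<in> _")
proof -
  have "?g (Op B f xs) = Op A f (map ?g xs)"
    if f: "f \<in> Symbols B" and xs: "xs \<in> args B f (Universe B)" for f xs
  proof -
    have op: "Op B f xs \<in> Universe B"
      using alg f xs by (auto simp: is_algebra_def closed_under_ops_def)
    have len: "length xs = Arity A f" and sub: "set xs \<subseteq> Universe B" and fA: "f \<in> Symbols A"
      using sim f xs by (auto simp: similar_def args_def)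
    have "map ?g xs = map (\<lambda>b. h b \<ominus> h' b \<oplus> h'' b) xs"
      using sub by auto
    moreover have "Op A f (map (\<lambda>b. h b \<ominus> h' b \<oplus> h'' b) xs) =
        Op A f (map h xs) \<ominus> Op A f (map h' xs) \<oplus> Op A f (map h'' xs)"
      using sub h by (intro op_commute[OF fA len]) (auto intro: Hom_mem)
    ultimately show ?thesis
      using op Hom_op[OF h(1) f xs] Hom_op[OF h(2) f xs] Hom_op[OF h(3) f xs]
      by (simp del: map_eq_conv)
  qed
  moreover have "?g \<in> Universe B \<rightarrow>\<^sub>E Universe A"
    using h[THEN Hom_mem] unfolding carrier_eq[symmetric] by (simp add: restrict_PiE_iff)
  ultimately show ?thesis by (simp add: Hom_def)
qed

text \<open>
  The ternary operation of \<open>A\<close> is a term, so it has a counterpart \<open>p\<close> on every similar algebra.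
\<close>

lemma ternary_operation_similar:
  assumes sim: "similar B A" and alg: "is_algebra B"
  obtains p where
    "\<And>x y z. \<lbrakk>x \<in> Universe B; y \<in> Universe B; z \<in> Universe B\<rbrakk> \<Longrightarrow> p x y z \<in> Universe B"
    "\<And>h x y z. \<lbrakk>h \<in> Hom B A; x \<in> Universe B; y \<in> Universe B; z \<in> Universe B\<rbrakk> \<Longrightarrow>
       h (p x y z) = h x \<ominus> h y \<oplus> h z"
proof -
  obtain t where wf: "wf_term A 3 t"
    and t: "\<And>x. x \<in> {..<3} \<rightarrow>\<^sub>E Universe A \<Longrightarrow> x 0 \<ominus> x 1 \<oplus> x 2 = eval_term A x t"
    using ternary by (auto simp: term_operation_def)
  have wfB: "wf_term B 3 t" using wf wf_term_similar[OF sim] by blast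
  define p where "p x y z = eval_term B (\<lambda>i. [x, y, z] ! i) t" for x y z
  have mem: "[x, y, z] ! i \<in> Universe B"
    if "i < 3" "x \<in> Universe B" "y \<in> Universe B" "z \<in> Universe B" for i x y z
    using that by (auto simp: less_Suc_eq numeral_3_eq_3)
  show ?thesis
  proof (rule that[of p])
    fix x y z assume "x \<in> Universe B" "y \<in> Universe B" "z \<in> Universe B"
    then show "p x y z \<in> Universe B"
      unfolding p_def using alg mem wfB
      by (intro eval_term_closed[where n = 3]) (auto simp: is_algebra_def)
  next
    fix h x y z
    assume h: "h \<in> Hom B A" and xyz: "x \<in> Universe B" "y \<in> Universe B" "z \<in> Universe B"
    let ?v = "\<lambda>i\<in>{..<3}. h ([x, y, z] ! i)"
    have "h (p x y z) = eval_term A (\<lambda>i. h ([x, y, z] ! i)) t"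
      unfolding p_def using mem xyz by (intro Hom_eval_term[OF alg wfB _ h]) auto
    also have "\<dots> = eval_term A ?v t"
      by (rule eval_term_cong[OF wf]) simp
    also have "\<dots> = ?v 0 \<ominus> ?v 1 \<oplus> ?v 2"
      using mem xyz h by (intro t[symmetric]) (auto intro: Hom_mem)
    finally show "h (p x y z) = h x \<ominus> h y \<oplus> h z" by (simp add: numeral_2_eq_2)
  qed
qed

text \<open>
  One character per group element suffices to separate points: \<open>x\<close> and \<open>y\<close> are told apart by the
  character that does not vanish at \<open>x \<ominus> y\<close>.
\<close>

lemma separating_family:
  assumes fin: "finite (carrier G)"
  obtains \<chi> :: "'a \<Rightarrow> 'a \<Rightarrow> int" where
    "\<And>a x y z. \<lbrakk>a \<in> carrier G; x \<in> carrier G; y \<in> carrier G; z \<in> carrier G\<rbrakk> \<Longrightarrow>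
       [\<chi> a (x \<ominus> y \<oplus> z) = \<chi> a x - \<chi> a y + \<chi> a z] (mod int (card (carrier G)))"
    "\<And>x y. \<lbrakk>x \<in> carrier G; y \<in> carrier G;
       \<And>a. a \<in> carrier G \<Longrightarrow> [\<chi> a x = \<chi> a y] (mod int (card (carrier G)))\<rbrakk> \<Longrightarrow> x = y"
proof -
  let ?m = "int (card (carrier G))"
  \<comment> \<open>at the index \<open>\<zero>\<close> the zero character serves as a default\<close>
  have "\<forall>a\<in>carrier G. \<exists>\<chi> :: 'a \<Rightarrow> int.
      (\<forall>x\<in>carrier G. \<forall>y\<in>carrier G. [\<chi> (x \<oplus> y) = \<chi> x + \<chi> y] (mod ?m)) \<and>
      (a \<noteq> \<zero> \<longrightarrow> \<not> [\<chi> a = 0] (mod ?m))"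
  proof
    fix a assume "a \<in> carrier G"
    then show "\<exists>\<chi> :: 'a \<Rightarrow> int.
      (\<forall>x\<in>carrier G. \<forall>y\<in>carrier G. [\<chi> (x \<oplus> y) = \<chi> x + \<chi> y] (mod ?m)) \<and>
      (a \<noteq> \<zero> \<longrightarrow> \<not> [\<chi> a = 0] (mod ?m))"
      using separating_character[OF fin, of a]
      by (cases "a = \<zero>") (auto intro: exI[of _ "\<lambda>_. 0"])
  qed
  then obtain \<chi> :: "'a \<Rightarrow> 'a \<Rightarrow> int" where
    add: "\<And>a x y. \<lbrakk>a \<in> carrier G; x \<in> carrier G; y \<in> carrier G\<rbrakk> \<Longrightarrow>
      [\<chi> a (x \<oplus> y) = \<chi> a x + \<chi> a y] (mod ?m)"
    and sep: "\<And>a. \<lbrakk>a \<in> carrier G; a \<noteq> \<zero>\<rbrakk> \<Longrightarrow> \<not> [\<chi> a a = 0] (mod ?m)"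
    unfolding bchoice_iff by blast
  have cancel: "x \<ominus> y \<oplus> y = x" if "x \<in> carrier G" "y \<in> carrier G" for x y
    using that by (simp add: minus_eq a_assoc l_neg)
  have diff: "[\<chi> a (x \<ominus> y) = \<chi> a x - \<chi> a y] (mod ?m)"
    if "a \<in> carrier G" "x \<in> carrier G" "y \<in> carrier G" for a x y
  proof -
    have "[\<chi> a x = \<chi> a (x \<ominus> y) + \<chi> a y] (mod ?m)"
      using add[of a "x \<ominus> y" y] cancel that by simp
    then show ?thesis by (simp add: cong_iff_dvd_diff dvd_diff_commute algebra_simps)
  qed
  show ?thesis
  proof (rule that[of \<chi>])
    fix a x y z
    assume mem: "a \<in> carrier G" "x \<in> carrier G" "y \<in> carrier G" "z \<in> carrier G"
    have "[\<chi> a (x \<ominus> y \<oplus> z) = \<chi> a (x \<ominus> y) + \<chi> a z] (mod ?m)"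
      using mem by (intro add) auto
    also have "[\<chi> a (x \<ominus> y) + \<chi> a z = \<chi> a x - \<chi> a y + \<chi> a z] (mod ?m)"
      using diff mem by (intro cong_add) auto
    finally show "[\<chi> a (x \<ominus> y \<oplus> z) = \<chi> a x - \<chi> a y + \<chi> a z] (mod ?m)" .
  next
    fix x y
    assume mem: "x \<in> carrier G" "y \<in> carrier G"
      and eq: "\<And>a. a \<in> carrier G \<Longrightarrow> [\<chi> a x = \<chi> a y] (mod ?m)"
    have "[\<chi> (x \<ominus> y) (x \<ominus> y) = \<chi> (x \<ominus> y) x - \<chi> (x \<ominus> y) y] (mod ?m)"
      using diff mem by simp
    moreover have "[\<chi> (x \<ominus> y) x - \<chi> (x \<ominus> y) y = 0] (mod ?m)"
      using eq[of "x \<ominus> y"] mem by (simp add: cong_diff_iff_cong_0)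
    ultimately have "x \<ominus> y = \<zero>"
      using sep[of "x \<ominus> y"] mem by (meson cong_trans minus_closed)
    then show "x = y" using cancel[of x y] mem by simp
  qed
qed

end


section \<open>Double annihilators and dualizability\<close>

text \<open>
  A set of functions that contains \<open>0\<close> and is closed under \<open>u - v + w\<close> is a group, as
  \<open>u + w = u - 0 + w\<close> and \<open>- v = 0 - v + 0\<close>. The functions are only given through their indices, on
  which the operation is \<open>p\<close>.
\<close>

lemma integer_combination_realized:
  fixes u :: "'b \<Rightarrow> 'p \<Rightarrow> int"
  assumes closed: "\<And>x y z. \<lbrakk>x \<in> S; y \<in> S; z \<in> S\<rbrakk> \<Longrightarrow> p x y z \<in> S"
    and p: "\<And>x y z h. \<lbrakk>x \<in> S; y \<in> S; z \<in> S; h \<in> P\<rbrakk> \<Longrightarrow>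
      [u (p x y z) h = u x h - u y h + u z h] (mod m)"
    and e: "e \<in> S" "\<And>h. h \<in> P \<Longrightarrow> u e h = 0"
    and F: "finite F" "F \<subseteq> S"
  shows "\<exists>b\<in>S. \<forall>h\<in>P. [u b h = (\<Sum>x\<in>F. k x * u x h)] (mod m)"
proof -
  have comb: "\<exists>b\<in>S. \<forall>h\<in>P. [u b h = f h - g h + f' h] (mod m)"
    if "\<exists>b\<in>S. \<forall>h\<in>P. [u b h = f h] (mod m)" "\<exists>b\<in>S. \<forall>h\<in>P. [u b h = g h] (mod m)"
      "\<exists>b\<in>S. \<forall>h\<in>P. [u b h = f' h] (mod m)" for f g f'
  proof -
    obtain x y z where xyz: "x \<in> S" "y \<in> S" "z \<in> S"
      and eq: "\<forall>h\<in>P. [u x h = f h] (mod m)" "\<forall>h\<in>P. [u y h = g h] (mod m)"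
        "\<forall>h\<in>P. [u z h = f' h] (mod m)"
      using \<open>\<exists>b\<in>S. \<forall>h\<in>P. [u b h = f h] (mod m)\<close> \<open>\<exists>b\<in>S. \<forall>h\<in>P. [u b h = g h] (mod m)\<close>
        \<open>\<exists>b\<in>S. \<forall>h\<in>P. [u b h = f' h] (mod m)\<close> by blast
    have "[u (p x y z) h = f h - g h + f' h] (mod m)" if h: "h \<in> P" for h
    proof -
      have "[u x h - u y h + u z h = f h - g h + f' h] (mod m)"
        using eq h by (intro cong_add cong_diff) auto
      with p[OF xyz h] show ?thesis by (rule cong_trans)
    qed
    then show ?thesis using closed[OF xyz] by blast
  qed
  have zero: "\<exists>b\<in>S. \<forall>h\<in>P. [u b h = 0] (mod m)"
    using e by (intro bexI[of _ e]) auto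
  have multiple: "\<exists>b\<in>S. \<forall>h\<in>P. [u b h = j * u x h] (mod m)" if x: "x \<in> S" for x j
  proof (induction j rule: int_induct[where k = 0])
    case base
    show ?case using zero by simp
  next
    case (step1 j)
    have "\<exists>b\<in>S. \<forall>h\<in>P. [u b h = u x h] (mod m)" using x by (intro bexI[of _ x]) auto
    from comb[OF step1.IH zero this] show ?case by (simp add: algebra_simps)
  next
    case (step2 j)
    have "\<exists>b\<in>S. \<forall>h\<in>P. [u b h = u x h] (mod m)" using x by (intro bexI[of _ x]) auto
    from comb[OF step2.IH this zero] show ?case by (simp add: algebra_simps)
  qed
  show ?thesis
    using F
  proof (induction F)
    case empty
    show ?case using zero by simp
  next
    case (insert x F)
    then have "\<exists>b\<in>S. \<forall>h\<in>P. [u b h = (\<Sum>x\<in>F. k x * u x h)] (mod m)" by simp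
    from comb[OF multiple[of x "k x"] zero this] show ?case using insert by simp
  qed
qed

context affine_structure
begin

text \<open>
  The double annihilator argument. The index set of the families in \<open>P\<close> is the universe of \<open>A\<close>, matching the
  separating family \<open>\<chi>\<close>. A base point \<open>h0\<close> is fixed, and \<open>b0\<close> interpolates \<open>\<phi>\<close> at \<open>h0\<close>. Only elements
  of \<open>B'\<close>, those that interpolate \<open>\<phi>\<close> at \<open>h0\<close>, are admitted; together with the subtraction of the
  values at \<open>b0\<close> this makes \<open>u b\<close> and \<open>\<Psi>\<close> vanish at the constant family \<open>h0\<close>, so that they are additive
  when \<open>h0\<close> is taken as the origin of \<open>P\<close>, and not merely affine.
\<close>

theorem preserving_map_is_evaluation:
  assumes fin: "finite (Universe A)" and sim: "similar B A" and alg: "is_algebra B"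
    and cont: "continuous_map (Hom_topology B A) (discrete_topology (Universe A)) \<phi>"
    and pres: "\<And>\<rho>. compatible_relation A \<rho> \<Longrightarrow> preserves B A \<phi> \<rho>"
  shows "\<exists>b\<in>Universe B. \<forall>h\<in>Hom B A. \<phi> h = h b"
proof (cases "Hom B A = {}")
  case True
  then show ?thesis using alg by (auto simp: is_algebra_def)
next
  case False
  then obtain h0 where h0: "h0 \<in> Hom B A" by blast
  define m where "m = int (card (carrier G))"
  have finG: "finite (carrier G)" using fin by (simp add: carrier_eq)
  then have m: "m > 0" unfolding m_def using zero_closed by (simp add: card_gt_0_iff) blast
  have interpolate: "\<exists>b\<in>Universe B. \<forall>h\<in>H. \<phi> h = h b" if "finite H" "H \<subseteq> Hom B A" for H
    using finite_interpolation[OF sim alg pres that] .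
  have \<phi>_mem: "\<phi> h \<in> carrier G" if "h \<in> Hom B A" for h
    using cont that by (auto simp: continuous_map_def topspace_Hom_topology carrier_eq)
  have Hom_G: "h b \<in> carrier G" if "h \<in> Hom B A" "b \<in> Universe B" for h b
    using Hom_mem[OF that] by (simp add: carrier_eq)
  obtain b0 where b0: "b0 \<in> Universe B" "\<phi> h0 = h0 b0"
    using interpolate[of "{h0}"] h0 by auto
  obtain p where
    p_mem: "\<And>x y z. \<lbrakk>x \<in> Universe B; y \<in> Universe B; z \<in> Universe B\<rbrakk> \<Longrightarrow> p x y z \<in> Universe B"
    and p: "\<And>h x y z. \<lbrakk>h \<in> Hom B A; x \<in> Universe B; y \<in> Universe B; z \<in> Universe B\<rbrakk> \<Longrightarrow>
       h (p x y z) = h x \<ominus> h y \<oplus> h z"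
    using ternary_operation_similar[OF sim alg] by blast
  obtain \<chi> :: "'a \<Rightarrow> 'a \<Rightarrow> int" where
    \<chi>: "\<And>a x y z. \<lbrakk>a \<in> carrier G; x \<in> carrier G; y \<in> carrier G; z \<in> carrier G\<rbrakk> \<Longrightarrow>
       [\<chi> a (x \<ominus> y \<oplus> z) = \<chi> a x - \<chi> a y + \<chi> a z] (mod m)"
    and \<chi>_sep: "\<And>x y. \<lbrakk>x \<in> carrier G; y \<in> carrier G;
       \<And>a. a \<in> carrier G \<Longrightarrow> [\<chi> a x = \<chi> a y] (mod m)\<rbrakk> \<Longrightarrow> x = y"
    using separating_family[OF finG] unfolding m_def by blast

  define P where "P = carrier G \<rightarrow>\<^sub>E Hom B A"
  define B' where "B' = {b \<in> Universe B. h0 b = h0 b0}"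
  define u where "u b h = (\<Sum>a\<in>carrier G. \<chi> a (h a b) - \<chi> a (h a b0))" for b and h :: "'a \<Rightarrow> 'b \<Rightarrow> 'a"
  define \<Psi> where "\<Psi> h = (\<Sum>a\<in>carrier G. \<chi> a (\<phi> (h a)) - \<chi> a (h a b0))" for h :: "'a \<Rightarrow> 'b \<Rightarrow> 'a"
  have P_mem: "h a \<in> Hom B A" if "h \<in> P" "a \<in> carrier G" for h a
    using that by (auto simp: P_def)
  have B'_mem: "b \<in> Universe B" if "b \<in> B'" for b
    using that by (simp add: B'_def)

  \<comment> \<open>\<open>h - k + h0\<close> is the difference of \<open>h\<close> and \<open>k\<close> with respect to the origin \<open>h0\<close>\<close>
  have difference: "\<exists>z\<in>P. [\<Psi> z = \<Psi> h - \<Psi> k] (mod m) \<and> (\<forall>b\<in>B'. [u b z = u b h - u b k] (mod m))"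
    if h: "h \<in> P" and k: "k \<in> P" for h k
  proof -
    let ?g = "\<lambda>a. \<lambda>b\<in>Universe B. h a b \<ominus> k a b \<oplus> h0 b"
    define z where "z = restrict ?g (carrier G)"
    have g: "?g a \<in> Hom B A" if "a \<in> carrier G" for a
      using Hom_ternary[OF sim alg P_mem[OF h that] P_mem[OF k that] h0] .
    have z: "z \<in> P"
      using g by (simp add: z_def P_def restrict_PiE_iff)
    have z_app: "z a b = h a b \<ominus> k a b \<oplus> h0 b" if "a \<in> carrier G" "b \<in> Universe B" for a b
      using that by (simp add: z_def)
    \<comment> \<open>interpolation at four homomorphisms shows that \<open>\<phi>\<close> respects the ternary operation\<close>
    have \<phi>_z: "\<phi> (z a) = \<phi> (h a) \<ominus> \<phi> (k a) \<oplus> \<phi> h0" if a: "a \<in> carrier G" for a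
    proof -
      obtain b where "b \<in> Universe B" "\<forall>f\<in>{z a, h a, k a, h0}. \<phi> f = f b"
        using interpolate[of "{z a, h a, k a, h0}"] P_mem[OF _ a] h k z h0 by auto
      then show ?thesis using z_app[OF a] by simp
    qed
    have eval: "[\<chi> a (z a b) = \<chi> a (h a b) - \<chi> a (k a b) + \<chi> a (h0 b)] (mod m)"
      if "a \<in> carrier G" "b \<in> Universe B" for a b
      using \<chi>[of a "h a b" "k a b" "h0 b"] z_app that h0 P_mem[OF h] P_mem[OF k] by (simp add: Hom_G)
    have "[\<Psi> z = (\<Sum>a\<in>carrier G. (\<chi> a (\<phi> (h a)) - \<chi> a (\<phi> (k a)) + \<chi> a (\<phi> h0)) -
        (\<chi> a (h a b0) - \<chi> a (k a b0) + \<chi> a (h0 b0)))] (mod m)"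
      unfolding \<Psi>_def
    proof (intro cong_sum cong_diff)
      fix a assume a: "a \<in> carrier G"
      show "[\<chi> a (\<phi> (z a)) = \<chi> a (\<phi> (h a)) - \<chi> a (\<phi> (k a)) + \<chi> a (\<phi> h0)] (mod m)"
        using \<chi>[of a "\<phi> (h a)" "\<phi> (k a)" "\<phi> h0"] \<phi>_z[OF a] a h0 P_mem[OF h] P_mem[OF k]
        by (simp add: \<phi>_mem)
    qed (use eval b0 in auto)
    also have "(\<Sum>a\<in>carrier G. (\<chi> a (\<phi> (h a)) - \<chi> a (\<phi> (k a)) + \<chi> a (\<phi> h0)) -
        (\<chi> a (h a b0) - \<chi> a (k a b0) + \<chi> a (h0 b0))) = \<Psi> h - \<Psi> k"
      unfolding \<Psi>_def sum_subtractf[symmetric] by (intro sum.cong) (auto simp: b0(2))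
    finally have \<Psi>_z: "[\<Psi> z = \<Psi> h - \<Psi> k] (mod m)" .
    have u_z: "[u b z = u b h - u b k] (mod m)" if b: "b \<in> B'" for b
    proof -
      have "[u b z = (\<Sum>a\<in>carrier G. (\<chi> a (h a b) - \<chi> a (k a b) + \<chi> a (h0 b)) -
          (\<chi> a (h a b0) - \<chi> a (k a b0) + \<chi> a (h0 b0)))] (mod m)"
        unfolding u_def using eval b0 B'_mem[OF b] by (intro cong_sum cong_diff) auto
      also have "(\<Sum>a\<in>carrier G. (\<chi> a (h a b) - \<chi> a (k a b) + \<chi> a (h0 b)) -
          (\<chi> a (h a b0) - \<chi> a (k a b0) + \<chi> a (h0 b0))) = u b h - u b k"
        unfolding u_def sum_subtractf[symmetric] using b by (intro sum.cong) (auto simp: B'_def)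
      finally show ?thesis .
    qed
    show ?thesis using z \<Psi>_z u_z by blast
  qed

  \<comment> \<open>an element that interpolates \<open>\<phi>\<close> at \<open>h0\<close> and all entries of \<open>h\<close> belongs to \<open>B'\<close>\<close>
  have vanish: "[\<Psi> h = 0] (mod m)" if h: "h \<in> P" and u0: "\<forall>b\<in>B'. [u b h = 0] (mod m)" for h
  proof -
    have "finite (insert h0 (h ` carrier G))" "insert h0 (h ` carrier G) \<subseteq> Hom B A"
      using finG h0 P_mem[OF h] by auto
    from interpolate[OF this] obtain b where b: "b \<in> Universe B" "\<phi> h0 = h0 b"
        "\<And>a. a \<in> carrier G \<Longrightarrow> \<phi> (h a) = h a b" by auto
    then have "b \<in> B'" by (simp add: B'_def b0(2)[symmetric])
    moreover have "\<Psi> h = u b h"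
      unfolding \<Psi>_def u_def using b(3) by (intro sum.cong) auto
    ultimately show ?thesis using u0 by simp
  qed

  obtain F where F: "finite F" "F \<subseteq> B'"
    and vanish_F: "\<And>h. \<lbrakk>h \<in> P; \<forall>b\<in>F. [u b h = 0] (mod m)\<rbrakk> \<Longrightarrow> [\<Psi> h = 0] (mod m)"
  proof -
    let ?T = "product_topology (\<lambda>_ :: 'a. Hom_topology B A) (carrier G)"
    have top: "topspace ?T = P" by (simp add: P_def topspace_Hom_topology)
    have "compact_space ?T"
      using compact_space_Hom_topology[OF sim alg fin] by (simp add: compact_space_product_topology)
    have proj: "continuous_map ?T (Hom_topology B A) (\<lambda>h. h a)" if "a \<in> carrier G" for a
      using that by (rule continuous_map_product_projection)
    have cont_eval: "continuous_map ?T (discrete_topology (Universe A)) (\<lambda>h. h a b)"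
      if "a \<in> carrier G" "b \<in> Universe B" for a b
      using continuous_map_compose[OF proj continuous_map_Hom_eval, of a b] that by (simp add: o_def)
    have cont_\<phi>: "continuous_map ?T (discrete_topology (Universe A)) (\<lambda>h. \<phi> (h a))"
      if "a \<in> carrier G" for a
      using continuous_map_compose[OF proj cont, of a] that by (simp add: o_def)
    have cont_u: "continuous_map ?T (discrete_topology UNIV) (u b)" if "b \<in> Universe B" for b
      unfolding u_def
      using continuous_map_discrete_combine[OF cont_eval cont_eval, of _ b _ b0 "\<lambda>x y. \<chi> _ x - \<chi> _ y"] that b0
      by (intro continuous_map_discrete_sum) auto
    have cont_\<Psi>: "continuous_map ?T (discrete_topology UNIV) \<Psi>"
      unfolding \<Psi>_def
      using continuous_map_discrete_combine[OF cont_\<phi> cont_eval, of _ _ b0 "\<lambda>x y. \<chi> _ x - \<chi> _ y"] b0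
      by (intro continuous_map_discrete_sum) auto
    \<comment> \<open>the sets where some \<open>u b\<close> is nonzero and the set where \<open>\<Psi>\<close> is zero cover \<open>P\<close>\<close>
    define U where "U b = {h \<in> P. u b h \<in> {n. \<not> [n = 0] (mod m)}}" for b
    define V where "V = {h \<in> P. \<Psi> h \<in> {n. [n = 0] (mod m)}}"
    have U_open: "openin ?T (U b)" if "b \<in> B'" for b
      unfolding U_def top[symmetric]
      by (rule openin_continuous_map_preimage[OF cont_u[OF B'_mem[OF that]]]) simp
    have V_open: "openin ?T V"
      unfolding V_def top[symmetric] by (rule openin_continuous_map_preimage[OF cont_\<Psi>]) simp
    have cover: "topspace ?T \<subseteq> V \<union> (\<Union>b\<in>B'. U b)"
      unfolding top using vanish by (auto simp: U_def V_def)
    obtain F where F: "finite F" "F \<subseteq> B'" "topspace ?T \<subseteq> V \<union> (\<Union>b\<in>F. U b)"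
      using compact_space_finite_subcover[OF \<open>compact_space ?T\<close> V_open U_open cover] by blast
    show ?thesis
    proof (rule that[OF F(1,2)])
      fix h assume "h \<in> P" "\<forall>b\<in>F. [u b h = 0] (mod m)"
      then show "[\<Psi> h = 0] (mod m)"
        using F(3) unfolding top by (auto simp: U_def V_def)
    qed
  qed

  obtain k where k: "\<And>h. h \<in> P \<Longrightarrow> [\<Psi> h = (\<Sum>b\<in>F. k b * u b h)] (mod m)"
  proof -
    have "\<exists>k. \<forall>h\<in>P. [\<Psi> h = (\<Sum>b\<in>F. k b * u b h)] (mod m)"
    proof (rule cong_combination_of_functionals[OF m F(1)])
      fix h h' assume "h \<in> P" "h' \<in> P"
      from difference[OF this] F(2)
      show "\<exists>z\<in>P. [\<Psi> z = \<Psi> h - \<Psi> h'] (mod m) \<and> (\<forall>b\<in>F. [u b z = u b h - u b h'] (mod m))"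
        by blast
    qed (rule vanish_F)
    with that show ?thesis by blast
  qed

  have combine: "p x y z \<in> B'" "h \<in> P \<Longrightarrow> [u (p x y z) h = u x h - u y h + u z h] (mod m)"
    if xyz: "x \<in> B'" "y \<in> B'" "z \<in> B'" for x y z h
  proof -
    note mem = xyz[THEN B'_mem]
    have "h0 (p x y z) = h0 b0 \<ominus> h0 b0 \<oplus> h0 b0"
      using p[OF h0 mem] xyz by (simp add: B'_def)
    also have "\<dots> = h0 b0"
      using Hom_G[OF h0 b0(1)] by (simp add: minus_eq r_neg)
    finally show "p x y z \<in> B'"
      using p_mem[OF mem] by (simp add: B'_def)
    show "[u (p x y z) h = u x h - u y h + u z h] (mod m)" if h: "h \<in> P"
    proof -
      have "[u (p x y z) h =
          (\<Sum>a\<in>carrier G. (\<chi> a (h a x) - \<chi> a (h a y) + \<chi> a (h a z)) - \<chi> a (h a b0))] (mod m)"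
        unfolding u_def using p[OF P_mem[OF h] mem] \<chi> Hom_G[OF P_mem[OF h]] mem
        by (intro cong_sum cong_diff) auto
      also have "(\<Sum>a\<in>carrier G. (\<chi> a (h a x) - \<chi> a (h a y) + \<chi> a (h a z)) - \<chi> a (h a b0)) =
          u x h - u y h + u z h"
        unfolding u_def sum_subtractf[symmetric] sum.distrib[symmetric] by (intro sum.cong) auto
      finally show ?thesis .
    qed
  qed
  have b0': "b0 \<in> B'" and u_b0: "u b0 h = 0" for h
    using b0 by (auto simp: B'_def u_def)
  have "\<exists>b\<in>B'. \<forall>h\<in>P. [u b h = (\<Sum>x\<in>F. k x * u x h)] (mod m)"
    using combine b0' u_b0 F
    by (intro integer_combination_realized[where p = p and e = b0]) auto
  then obtain b where b: "b \<in> B'" "\<And>h. h \<in> P \<Longrightarrow> [u b h = (\<Sum>x\<in>F. k x * u x h)] (mod m)"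
    by blast
  have \<Psi>_u: "[\<Psi> h = u b h] (mod m)" if "h \<in> P" for h
    using k[OF that] b(2)[OF that] by (meson cong_sym cong_trans)

  have "\<phi> h = h b" if h: "h \<in> Hom B A" for h
  proof (rule \<chi>_sep)
    show "\<phi> h \<in> carrier G" "h b \<in> carrier G"
      using \<phi>_mem[OF h] Hom_G[OF h B'_mem[OF b(1)]] by auto
    fix a assume a: "a \<in> carrier G"
    \<comment> \<open>the entries equal to \<open>h0\<close> contribute \<open>0\<close> to both sums\<close>
    define g where "g = (\<lambda>c\<in>carrier G. if c = a then h else h0)"
    have g: "g \<in> P" using h h0 by (simp add: g_def P_def restrict_PiE_iff)
    have "\<Psi> g = (\<Sum>c\<in>carrier G. if c = a then \<chi> a (\<phi> h) - \<chi> a (h b0) else 0)"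
      unfolding \<Psi>_def g_def by (intro sum.cong) (auto simp: b0(2))
    also have "\<dots> = \<chi> a (\<phi> h) - \<chi> a (h b0)"
      using a finG by simp
    finally have 1: "\<Psi> g = \<chi> a (\<phi> h) - \<chi> a (h b0)" .
    have "u b g = (\<Sum>c\<in>carrier G. if c = a then \<chi> a (h b) - \<chi> a (h b0) else 0)"
      unfolding u_def g_def using b(1) by (intro sum.cong) (auto simp: B'_def)
    also have "\<dots> = \<chi> a (h b) - \<chi> a (h b0)"
      using a finG by simp
    finally show "[\<chi> a (\<phi> h) = \<chi> a (h b)] (mod m)"
      using \<Psi>_u[OF g] 1 by (simp add: cong_iff_dvd_diff)
  qed
  then show ?thesis using B'_mem[OF b(1)] by blast
qed

end

theorem finite_affine_algebra_dualizable:
  fixes A :: "('f, 'a) ualg"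
  assumes "finite (Universe A)" and "affine_algebra A"
  shows "dualizable TYPE('b) TYPE('i) A"
proof -
  obtain G :: "'a ring" where G: "abelian_group G" "carrier G = Universe A"
      "term_operation A 3 (\<lambda>x. x 0 \<ominus>\<^bsub>G\<^esub> x 1 \<oplus>\<^bsub>G\<^esub> x 2)"
      "\<forall>n t. term_operation A n t \<longrightarrow>
        (\<forall>x \<in> {..<n} \<rightarrow>\<^sub>E Universe A. \<forall>y \<in> {..<n} \<rightarrow>\<^sub>E Universe A. \<forall>z \<in> {..<n} \<rightarrow>\<^sub>E Universe A.
          t (\<lambda>i\<in>{..<n}. x i \<ominus>\<^bsub>G\<^esub> y i \<oplus>\<^bsub>G\<^esub> z i) = t x \<ominus>\<^bsub>G\<^esub> t y \<oplus>\<^bsub>G\<^esub> t z)"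
    using assms(2) unfolding affine_algebra_def by blast
  then have "affine_structure G A"
    unfolding affine_structure_def affine_structure_axioms_def by blast
  then interpret affine_structure G A .
  show ?thesis
    unfolding dualizable_iff_all_compatible_relations dualized_by_def
  proof (intro allI impI)
    fix B :: "('f, 'b) ualg" and \<phi>
    assume "in_SP TYPE('i) A B"
      and \<phi>: "continuous_map (Hom_topology B A) (discrete_topology (Universe A)) \<phi> \<and>
        (\<forall>\<rho>\<in>{\<rho>. compatible_relation A \<rho>}. preserves B A \<phi> \<rho>)"
    then have "is_algebra B" "similar B A"
      by (auto simp: in_SP_def isomorphic_def similar_def subalg_def power_alg_def)
    with \<phi> assms(1) show "\<exists>b\<in>Universe B. \<forall>h\<in>Hom B A. \<phi> h = h b"
      by (intro preserving_map_is_evaluation) auto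
  qed
qed


section \<open>Modules\<close>

context left_module
begin

text \<open>
  The case of addition in the claim that all terms commute with \<open>x - y + z\<close>.
\<close>

lemma ternary_interchange:
  assumes "x \<in> carrier M" "x' \<in> carrier M" "y \<in> carrier M" "y' \<in> carrier M"
    "z \<in> carrier M" "z' \<in> carrier M"
  shows "(x \<oplus>\<^bsub>M\<^esub> x') \<ominus>\<^bsub>M\<^esub> (y \<oplus>\<^bsub>M\<^esub> y') \<oplus>\<^bsub>M\<^esub> (z \<oplus>\<^bsub>M\<^esub> z') =
    (x \<ominus>\<^bsub>M\<^esub> y \<oplus>\<^bsub>M\<^esub> z) \<oplus>\<^bsub>M\<^esub> (x' \<ominus>\<^bsub>M\<^esub> y' \<oplus>\<^bsub>M\<^esub> z')"
  using assms by (simp add: M.minus_eq M.minus_add M.a_ac)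

lemma is_algebra_module_algebra: "is_algebra (module_algebra R M)"
  by (auto simp: is_algebra_def closed_under_ops_def module_algebra_def args_def
      length_Suc_conv numeral_2_eq_2 smult_closed)

lemma smult_uminus:
  assumes "r \<in> carrier R" "u \<in> carrier M"
  shows "r \<odot>\<^bsub>M\<^esub> (\<ominus>\<^bsub>M\<^esub> u) = \<ominus>\<^bsub>M\<^esub> (r \<odot>\<^bsub>M\<^esub> u)"
proof -
  have "r \<odot>\<^bsub>M\<^esub> \<zero>\<^bsub>M\<^esub> \<oplus>\<^bsub>M\<^esub> r \<odot>\<^bsub>M\<^esub> \<zero>\<^bsub>M\<^esub> = r \<odot>\<^bsub>M\<^esub> \<zero>\<^bsub>M\<^esub>"
    using smult_r_distr[of r "\<zero>\<^bsub>M\<^esub>" "\<zero>\<^bsub>M\<^esub>"] assms by simp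
  then have zero: "r \<odot>\<^bsub>M\<^esub> \<zero>\<^bsub>M\<^esub> = \<zero>\<^bsub>M\<^esub>"
    using smult_closed assms by (metis M.add.l_cancel_one M.zero_closed)
  have "r \<odot>\<^bsub>M\<^esub> (\<ominus>\<^bsub>M\<^esub> u) \<oplus>\<^bsub>M\<^esub> r \<odot>\<^bsub>M\<^esub> u = \<zero>\<^bsub>M\<^esub>"
    using smult_r_distr[of r "\<ominus>\<^bsub>M\<^esub> u" u] assms zero by (simp add: M.l_neg)
  then show ?thesis
    using assms smult_closed by (simp add: M.minus_equality)
qed

lemma eval_term_ternary:
  assumes "wf_term (module_algebra R M) n t"
    and "\<And>i. i < n \<Longrightarrow> x i \<in> carrier M" "\<And>i. i < n \<Longrightarrow> y i \<in> carrier M"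
      "\<And>i. i < n \<Longrightarrow> z i \<in> carrier M"
  shows "eval_term (module_algebra R M) (\<lambda>i\<in>{..<n}. x i \<ominus>\<^bsub>M\<^esub> y i \<oplus>\<^bsub>M\<^esub> z i) t =
    eval_term (module_algebra R M) x t \<ominus>\<^bsub>M\<^esub> eval_term (module_algebra R M) y t
      \<oplus>\<^bsub>M\<^esub> eval_term (module_algebra R M) z t"
  using assms(1)
proof (induction t)
  case (Var i)
  then show ?case by simp
next
  case (App f ts)
  let ?A = "module_algebra R M"
  have closed: "eval_term ?A v t \<in> carrier M"
    if "t \<in> set ts" "\<And>i. i < n \<Longrightarrow> v i \<in> carrier M" for t v
    using is_algebra_module_algebra App.prems that
    by (intro eval_term_closed[where n = n]) (auto simp: is_algebra_def module_algebra_def)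
  \<comment> \<open>the tuple is kept opaque so that rewriting does not unfold the restriction\<close>
  define w where "w = (\<lambda>i\<in>{..<n}. x i \<ominus>\<^bsub>M\<^esub> y i \<oplus>\<^bsub>M\<^esub> z i)"
  have IH: "eval_term ?A w t =
      eval_term ?A x t \<ominus>\<^bsub>M\<^esub> eval_term ?A y t \<oplus>\<^bsub>M\<^esub> eval_term ?A z t" if "t \<in> set ts" for t
    unfolding w_def using App.prems that by (intro App.IH) auto
  have closed': "eval_term ?A x t \<in> carrier M" "eval_term ?A y t \<in> carrier M"
      "eval_term ?A z t \<in> carrier M" if "t \<in> set ts" for t
    using closed[OF that] assms(2-4) by auto
  have f: "f \<in> {Plus, Neg, Zero} \<union> Scalar ` carrier R" and len: "length ts = module_arity f"
    using App.prems by (auto simp: module_algebra_def)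
  have Op: "Op ?A = module_op M" by (simp add: module_algebra_def)
  from f consider "f = Plus" | "f = Neg" | "f = Zero" | r where "f = Scalar r" "r \<in> carrier R"
    by blast
  then have "eval_term ?A w (App f ts) =
      eval_term ?A x (App f ts) \<ominus>\<^bsub>M\<^esub> eval_term ?A y (App f ts) \<oplus>\<^bsub>M\<^esub> eval_term ?A z (App f ts)"
  proof cases
    case 1
    then obtain t t' where ts: "ts = [t, t']"
      using len by (auto simp: length_Suc_conv numeral_2_eq_2)
    then show ?thesis
      using 1 IH[of t] IH[of t'] closed'[of t] closed'[of t'] by (simp add: Op ternary_interchange)
  next
    case 2
    then obtain t where ts: "ts = [t]"
      using len by (auto simp: length_Suc_conv)
    then show ?thesis
      using 2 IH[of t] closed'[of t] by (simp add: Op M.minus_eq M.minus_add)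
  next
    case 3
    then show ?thesis by (simp add: Op M.minus_eq M.r_neg)
  next
    case 4
    then obtain t where ts: "ts = [t]"
      using len by (auto simp: length_Suc_conv)
    then show ?thesis
      using 4 IH[of t] closed'[of t]
      by (simp add: Op M.minus_eq smult_r_distr smult_uminus smult_closed)
  qed
  then show ?case unfolding w_def .
qed

lemma affine_algebra_module_algebra: "affine_algebra (module_algebra R M)"
  unfolding affine_algebra_def
proof (intro exI conjI allI impI ballI)
  let ?A = "module_algebra R M"
  define G where "G = ring.truncate M"
  have G_simps: "carrier G = carrier M" "zero G = zero M" "add G = add M"
    by (simp_all add: G_def ring.defs)
  show "abelian_group G"
    by (rule abelian_groupI)
      (auto simp: G_simps M.a_ac intro: bexI[of _ "\<ominus>\<^bsub>M\<^esub> _"] M.l_neg)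
  show carrier: "carrier G = Universe ?A"
    by (simp add: G_simps module_algebra_def)
  have minus: "x \<ominus>\<^bsub>G\<^esub> y = x \<ominus>\<^bsub>M\<^esub> y" for x y
    by (simp add: a_minus_def a_inv_def m_inv_def G_simps)
  have add: "x \<oplus>\<^bsub>G\<^esub> y = x \<oplus>\<^bsub>M\<^esub> y" for x y
    by (simp add: G_simps)
  show "term_operation ?A 3 (\<lambda>x. x 0 \<ominus>\<^bsub>G\<^esub> x 1 \<oplus>\<^bsub>G\<^esub> x 2)"
    unfolding term_operation_def minus add
    by (rule exI[of _ "App Plus [App Plus [Var 0, App Neg [Var 1]], Var 2]"])
      (auto simp: module_algebra_def M.minus_eq)
  fix n t x y z
  assume t: "term_operation ?A n t" and xyz: "x \<in> {..<n} \<rightarrow>\<^sub>E Universe ?A"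
    "y \<in> {..<n} \<rightarrow>\<^sub>E Universe ?A" "z \<in> {..<n} \<rightarrow>\<^sub>E Universe ?A"
  obtain s where s: "wf_term ?A n s"
    and ts: "\<And>x. x \<in> {..<n} \<rightarrow>\<^sub>E Universe ?A \<Longrightarrow> t x = eval_term ?A x s"
    using t by (auto simp: term_operation_def)
  have mem: "x i \<in> carrier M" "y i \<in> carrier M" "z i \<in> carrier M" if "i < n" for i
    using xyz that by (auto simp: module_algebra_def)
  have "(\<lambda>i\<in>{..<n}. x i \<ominus>\<^bsub>M\<^esub> y i \<oplus>\<^bsub>M\<^esub> z i) \<in> {..<n} \<rightarrow>\<^sub>E Universe ?A"
    using mem by (auto simp: module_algebra_def)
  then show "t (\<lambda>i\<in>{..<n}. x i \<ominus>\<^bsub>G\<^esub> y i \<oplus>\<^bsub>G\<^esub> z i) = t x \<ominus>\<^bsub>G\<^esub> t y \<oplus>\<^bsub>G\<^esub> t z"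
    unfolding minus add using eval_term_ternary[OF s mem] ts xyz by simp
qed

end

theorem corollary6p10:
  "(\<forall>A :: ('f, 'a) ualg.
      is_algebra A \<and> finite (Universe A) \<and> affine_algebra A \<longrightarrow>
      dualizable TYPE('b) TYPE('i) A) \<and>
   (\<forall>(R :: ('r, 'x) ring_scheme) (M :: ('r, 'm, 'y) module_scheme).
      left_module R M \<and> finite (carrier M) \<longrightarrow>
      dualizable TYPE('c) TYPE('j) (module_algebra R M))"
proof (intro conjI allI impI)
  fix A :: "('f, 'a) ualg"
  assume "is_algebra A \<and> finite (Universe A) \<and> affine_algebra A"
  then show "dualizable TYPE('b) TYPE('i) A"
    by (intro finite_affine_algebra_dualizable) auto
next
  fix R :: "('r, 'x) ring_scheme" and M :: "('r, 'm, 'y) module_scheme"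
  assume M: "left_module R M \<and> finite (carrier M)"
  then have "affine_algebra (module_algebra R M)"
    using left_module.affine_algebra_module_algebra by blast
  with M show "dualizable TYPE('c) TYPE('j) (module_algebra R M)"
    by (intro finite_affine_algebra_dualizable) (auto simp: module_algebra_def)
qed

end
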